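(* Let $m,n,d$ be positive integers with $m>n$. Put $\beta=\lfloor nd/(m-n)\rfloor$ and $t=nd \bmod (m-n)$, and let $\mathcal K_{\ell p}$ be the complete eigenstructure of $m\times n$ matrix polynomials of grade $d$ consisting of: no elementary divisors (neither finite nor infinite); no right minimal indices; and the left minimal indices $$\underbrace{\beta+1,\dots,\beta+1}_{t},\ \underbrace{\beta,\dots,\beta}_{m-n-t}.$$ Then: (i) There exists an $m\times n$ complex matrix polynomial $K_{\ell p}$ of degree exactly $d$ and rank exactly $n$ with the complete eigenstructure $\mathcal K_{\ell p}$. (ii) $\overline{\mathrm{O}}(K_{\ell p})=\mathrm{POL}_{d,m\times n}$.
   Context: All matrices are complex. An $m\times n$ matrix polynomial of grade $d$ is an expression $P(\lambda)=\lambda^dA_d+\dots+\lambda A_1+A_0$ with $A_i\in\mathbb C^{m\times n}$ (so its degree is at most $d$; $A_d=0$ is allowed). $\mathrm{POL}_{d,m\times n}$ is the vector space of all of these, with the metric $d(P,P')=\big(\sum_{i=0}^d\|A_i-A_i'\|_F^2\big)^{1/2}$ ($\|\cdot\|_F$ the Frobenius norm). Rank means normal rank, i.e. the rank of $P(\lambda)$ over the field $\mathbb C(\lambda)$. By the Smith form, if $P$ has rank $r$ there are matrix polynomials $U(\lambda),V(\lambda)$ with nonzero constant determinants such that $U(\lambda)P(\lambda)V(\lambda)$ is zero except for diagonal entries $g_1(\lambda),\dots,g_r(\lambda)$ in the leading $r\times r$ block, where the $g_j$ are monic and $g_j\mid g_{j+1}$; these $g_j$ are unique. Write $g_j(\lambda)=\prod_k(\lambda-\alpha_k)^{\delta_{jk}}$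 with distinct $\alpha_k$ and $\delta_{jk}>0$. The $\alpha_k$ are the finite eigenvalues, and the factors $(\lambda-\alpha_k)^{\delta_{jk}}$, collected over all $j$ with repetitions, are the elementary divisors associated with finite eigenvalues. For $P$ of grade $d$, let $\mathrm{rev}\,P(\lambda)=\lambda^dP(1/\lambda)$; the elementary divisors of $P$ associated with the eigenvalue $\infty$ are the elementary divisors $\lambda^{\gamma}$, $\gamma>0$, of $\mathrm{rev}\,P$ associated with its eigenvalue $0$. A minimal basis of a subspace $\mathcal V$ of a space of vectors over $\mathbb C(\lambda)$ is a basis of $\mathcal V$ consisting of vector polynomials whose sum of degrees is minimal among all such bases; the ordered list of degrees is the same for every minimal basis and is called the list of minimal indices of $\mathcal V$. For $P$ of rank $r$, the right minimal indices of $P$ are the $n-r$ minimal indices of $\{x(\lambda)\in\mathbb C(\lambda)^{n\times 1}: P(\lambda)x(\lambda)=0\}$ and the left minimal indices of $P$ are the $m-r$ minimal indices of $\{y(\lambda)^T\in\mathbb C(\lambda)^{1\times m}: y(\lambda)^TP(\lambda)=0\}$. The complete eigenstructure of $P$ (of grade $d$) consists of all its eigenvalues, finite and infinite, the corresponding elementary divisors, and its left and right minimal indices. $\mathrm{O}(P)$ denotes the set of all matrix polynomials of the same size, the same grade $d$ and with the same complete eigenstructure as $P$; $\overline{\mathrm{O}}(P)$ denotes its closure in the metric space $\mathrm{POL}_{d,m\times n}$. *)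

theory Defs
  imports
    "HOL-Library.Multiset"
    "HOL-Analysis.L2_Norm"
    "HOL-Analysis.Abstract_Metric_Spaces"
    "Jordan_Normal_Form.DL_Rank"
    "Jordan_Normal_Form.Matrix_Kernel"
begin

section \<open>Matrix polynomials of bounded grade\<close>

text \<open>A matrix polynomial is a matrix with polynomial entries; \<open>coeff_mat m n P i\<close> is the
  coefficient \<open>A\<^sub>i\<close> of an \<open>m\<close> by \<open>n\<close> matrix \<open>P\<close>; the sizes are explicit so that \<open>pol_dist\<close> is
  symmetric on the whole type, as the locale \<open>Metric_space\<close> requires. The grade is not stored in the object but is a parameter of the notions that
  depend on it.\<close>

definition POL :: "nat \<Rightarrow> nat \<Rightarrow> nat \<Rightarrow> complex poly mat set" where
  "POL d m n = {P \<in> carrier_mat m n. \<forall>i<m. \<forall>j<n. degree (P $$ (i, j)) \<le> d}"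

definition coeff_mat :: "nat \<Rightarrow> nat \<Rightarrow> complex poly mat \<Rightarrow> nat \<Rightarrow> complex mat" where
  "coeff_mat m n P i = mat m n (\<lambda>jk. coeff (P $$ jk) i)"

definition frobenius_norm :: "complex mat \<Rightarrow> real" where
  "frobenius_norm A = sqrt (\<Sum>i<dim_row A. \<Sum>j<dim_col A. (cmod (A $$ (i, j)))\<^sup>2)"

definition pol_dist :: "nat \<Rightarrow> nat \<Rightarrow> nat \<Rightarrow> complex poly mat \<Rightarrow> complex poly mat \<Rightarrow> real" where
  "pol_dist d m n P Q =
     sqrt (\<Sum>i\<le>d. (frobenius_norm (coeff_mat m n P i - coeff_mat m n Q i))\<^sup>2)"

text \<open>Not applied to matrices without entries; the zero matrix polynomial gets degree 0.\<close>

definition matpoly_degree :: "complex poly mat \<Rightarrow> nat" where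
  "matpoly_degree P = Max ((\<lambda>ij. degree (P $$ ij)) ` ({..<dim_row P} \<times> {..<dim_col P}))"

abbreviation to_rational_mat :: "complex poly mat \<Rightarrow> complex poly fract mat" where
  "to_rational_mat \<equiv> map_mat to_fract"

definition normal_rank :: "complex poly mat \<Rightarrow> nat" where
  "normal_rank P = vec_space.rank (dim_row P) (to_rational_mat P)"

section \<open>Smith form and elementary divisors\<close>

definition unimodular :: "nat \<Rightarrow> complex poly mat \<Rightarrow> bool" where
  "unimodular k U \<longleftrightarrow> U \<in> carrier_mat k k \<and> (\<exists>c. c \<noteq> 0 \<and> det U = [:c:])"

text \<open>\<open>gs\<close> is the (unique) list of the diagonal polynomials of the Smith form of \<open>P\<close>.\<close>

definition smith_invariants :: "complex poly mat \<Rightarrow> complex poly list \<Rightarrow> bool" where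
  "smith_invariants P gs \<longleftrightarrow>
     length gs = normal_rank P \<and>
     (\<forall>g \<in> set gs. lead_coeff g = 1) \<and>
     (\<forall>j. Suc j < length gs \<longrightarrow> gs ! j dvd gs ! Suc j) \<and>
     (\<exists>U V. unimodular (dim_row P) U \<and> unimodular (dim_col P) V \<and>
        U * P * V = mat (dim_row P) (dim_col P)
          (\<lambda>(i, j). if i = j \<and> i < length gs then gs ! i else 0))"

text \<open>The factors \<open>(\<lambda> - \<alpha>)\<^bsup>\<delta>\<^esup>\<close>, \<open>\<delta> > 0\<close>, occurring in the members of \<open>gs\<close>, with repetitions.\<close>

definition elementary_divisors_at :: "complex poly list \<Rightarrow> complex \<Rightarrow> complex poly multiset" where
  "elementary_divisors_at gs \<alpha> =
     image_mset (\<lambda>g. [:-\<alpha>, 1:] ^ order \<alpha> g) (filter_mset (\<lambda>g. poly g \<alpha> = 0) (mset gs))"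

text \<open>\<open>rev_poly d p\<close> is \<open>\<lambda>\<^sup>d p(1/\<lambda>)\<close> for \<open>degree p \<le> d\<close>; it differs from \<open>reflect_poly p\<close> by the
  factor \<open>\<lambda>\<close> to the power \<open>d - degree p\<close>.\<close>

definition rev_poly :: "nat \<Rightarrow> complex poly \<Rightarrow> complex poly" where
  "rev_poly d p = (\<Sum>i\<le>d. monom (coeff p (d - i)) i)"

definition rev_mat :: "nat \<Rightarrow> complex poly mat \<Rightarrow> complex poly mat" where
  "rev_mat d P = map_mat (rev_poly d) P"

section \<open>Minimal bases and minimal indices\<close>

definition vec_degree :: "complex poly vec \<Rightarrow> nat" where
  "vec_degree v = Max ((\<lambda>i. degree (v $ i)) ` {..<dim_vec v})"

text \<open>Here \<open>W\<close> is a subspace of \<open>k\<close>-vectors over the field of rational functions.\<close>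

definition polynomial_basis :: "nat \<Rightarrow> complex poly fract vec set \<Rightarrow> complex poly vec set \<Rightarrow> bool" where
  "polynomial_basis k W B \<longleftrightarrow>
     vectorspace.basis class_ring (module_vec TYPE(complex poly fract) k \<lparr>carrier := W\<rparr>)
       (map_vec to_fract ` B)"

definition minimal_basis :: "nat \<Rightarrow> complex poly fract vec set \<Rightarrow> complex poly vec set \<Rightarrow> bool" where
  "minimal_basis k W B \<longleftrightarrow>
     polynomial_basis k W B \<and>
     (\<forall>B'. polynomial_basis k W B' \<longrightarrow> (\<Sum>v\<in>B. vec_degree v) \<le> (\<Sum>v\<in>B'. vec_degree v))"

text \<open>An ordered list of degrees is the same thing as the multiset of the degrees.\<close>

definition minimal_indices :: "nat \<Rightarrow> complex poly fract vec set \<Rightarrow> nat multiset \<Rightarrow> bool" where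
  "minimal_indices k W ms \<longleftrightarrow>
     (\<exists>B. minimal_basis k W B \<and> ms = image_mset vec_degree (mset_set B))"

definition right_minimal_indices :: "complex poly mat \<Rightarrow> nat multiset \<Rightarrow> bool" where
  "right_minimal_indices P = minimal_indices (dim_col P) (mat_kernel (to_rational_mat P))"

text \<open>The left null space consists of row vectors; it is represented by the transposed columns.\<close>

definition left_minimal_indices :: "complex poly mat \<Rightarrow> nat multiset \<Rightarrow> bool" where
  "left_minimal_indices P =
     minimal_indices (dim_row P) (mat_kernel (transpose_mat (to_rational_mat P)))"

section \<open>Complete eigenstructure and orbit\<close>

text \<open>The eigenvalues need no fields of their own: \<open>\<alpha>\<close> is a finite eigenvalue iff
  \<open>finite_elem_divs E \<alpha> \<noteq> {#}\<close>, and \<open>\<infinity>\<close> is an eigenvalue iff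
  \<open>infinite_elem_divs E \<noteq> {#}\<close>.\<close>

record eigenstructure =
  finite_elem_divs :: "complex \<Rightarrow> complex poly multiset"
  infinite_elem_divs :: "complex poly multiset"
  right_indices :: "nat multiset"
  left_indices :: "nat multiset"

definition has_complete_eigenstructure :: "nat \<Rightarrow> complex poly mat \<Rightarrow> eigenstructure \<Rightarrow> bool" where
  "has_complete_eigenstructure d P E \<longleftrightarrow>
     (\<exists>gs. smith_invariants P gs \<and> finite_elem_divs E = elementary_divisors_at gs) \<and>
     (\<exists>hs. smith_invariants (rev_mat d P) hs \<and>
        infinite_elem_divs E = elementary_divisors_at hs 0) \<and>
     right_minimal_indices P (right_indices E) \<and>
     left_minimal_indices P (left_indices E)"

definition same_complete_eigenstructure :: "nat \<Rightarrow> complex poly mat \<Rightarrow> complex poly mat \<Rightarrow> bool" where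
  "same_complete_eigenstructure d P Q \<longleftrightarrow>
     (\<exists>E. has_complete_eigenstructure d P E \<and> has_complete_eigenstructure d Q E)"

definition orbit :: "nat \<Rightarrow> complex poly mat \<Rightarrow> complex poly mat set" where
  "orbit d P = {Q \<in> POL d (dim_row P) (dim_col P). same_complete_eigenstructure d P Q}"

definition orbit_closure :: "nat \<Rightarrow> complex poly mat \<Rightarrow> complex poly mat set" where
  "orbit_closure d P =
     Metric_space.mtopology (POL d (dim_row P) (dim_col P)) (pol_dist d (dim_row P) (dim_col P))
       closure_of orbit d P"

definition Klp_eigenstructure :: "nat \<Rightarrow> nat \<Rightarrow> nat \<Rightarrow> eigenstructure" where
  "Klp_eigenstructure m n d =
     (let \<beta> = (n * d) div (m - n); t = (n * d) mod (m - n)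
      in \<lparr>finite_elem_divs = (\<lambda>_. {#}),
          infinite_elem_divs = {#},
          right_indices = {#},
          left_indices = replicate_mset t (\<beta> + 1) + replicate_mset (m - n - t) \<beta>\<rparr>)"

section \<open>The metric space of matrix polynomials\<close>

lemma pol_dist_L2_set:
  "pol_dist d m n P Q =
    L2_set (\<lambda>(k, i, j). cmod (coeff (P $$ (i, j)) k - coeff (Q $$ (i, j)) k))
      ({..d} \<times> {..<m} \<times> {..<n})"
  by (simp add: pol_dist_def frobenius_norm_def coeff_mat_def L2_set_def sum_nonneg
      sum.cartesian_product' case_prod_unfold)

lemma Metric_space_POL: "Metric_space (POL d m n) (pol_dist d m n)"
proof
  show "0 \<le> pol_dist d m n P Q" for P Q
    by (simp add: pol_dist_L2_set)
  show "pol_dist d m n P Q = pol_dist d m n Q P" for P Q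
    by (simp add: pol_dist_L2_set norm_minus_commute)
next
  fix P Q assume PQ: "P \<in> POL d m n" "Q \<in> POL d m n"
  have "P = Q" if "\<forall>k\<le>d. \<forall>i<m. \<forall>j<n. coeff (P $$ (i, j)) k = coeff (Q $$ (i, j)) k"
  proof (rule eq_matI)
    fix i j assume "i < dim_row Q" "j < dim_col Q"
    then have ij: "i < m" "j < n" using PQ by (auto simp: POL_def)
    show "P $$ (i, j) = Q $$ (i, j)"
    proof (rule poly_eqI)
      fix k
      show "coeff (P $$ (i, j)) k = coeff (Q $$ (i, j)) k"
      proof (cases "k \<le> d")
        case True
        then show ?thesis using that ij by blast
      next
        case False
        moreover have "degree (P $$ (i, j)) \<le> d" "degree (Q $$ (i, j)) \<le> d"
          using PQ ij by (auto simp: POL_def)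
        ultimately show ?thesis by (simp add: coeff_eq_0)
      qed
    qed
  qed (use PQ in \<open>auto simp: POL_def\<close>)
  then show "pol_dist d m n P Q = 0 \<longleftrightarrow> P = Q"
    by (auto simp: pol_dist_L2_set L2_set_eq_0_iff)
next
  fix P Q R :: "complex poly mat"
  have "pol_dist d m n P R \<le> L2_set (\<lambda>(k, i, j).
      cmod (coeff (P $$ (i, j)) k - coeff (Q $$ (i, j)) k) +
      cmod (coeff (Q $$ (i, j)) k - coeff (R $$ (i, j)) k)) ({..d} \<times> {..<m} \<times> {..<n})"
    unfolding pol_dist_L2_set
    by (rule L2_set_mono) (auto intro: norm_diff_triangle_le)
  also have "\<dots> \<le> pol_dist d m n P Q + pol_dist d m n Q R"
    unfolding pol_dist_L2_set case_prod_unfold by (rule L2_set_triangle_ineq)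
  finally show "pol_dist d m n P R \<le> pol_dist d m n P Q + pol_dist d m n Q R" .
qed

end

theory Submission
  imports Defs "Jordan_Normal_Form.Char_Poly" "Subresultants.More_Homomorphisms"
begin

text \<open>Write \<open>q = m - n\<close>. A left null vector of degree at most \<open>\<beta>\<close> solves \<open>n (d + \<beta> + 1)\<close> linear
  equations in \<open>m (\<beta> + 1)\<close> unknowns; prescribing the \<open>\<beta>\<close>-th coefficients of its first \<open>s = q - t\<close> entries
  makes the system square. If this system and an \<open>n\<close> by \<open>n\<close> block of the leading coefficient are
  nonsingular (\<open>Q\<close> is \<open>good\<close>), then there are \<open>s\<close> null vectors of degree \<open>\<beta>\<close> and \<open>t\<close> of degree
  \<open>\<beta> + 1\<close> whose leading coefficients are in echelon form, so that they freely generate the polynomial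
  left null vectors. Together with left inverses of \<open>Q\<close> and of its reversal, which also come from
  the solvability of the system, they form unimodular matrices reducing \<open>Q\<close> and its reversal to
  an identity block, so there are no elementary divisors. Any other polynomial basis of the
  left null space has at most \<open>s\<close> vectors of degree at most \<open>\<beta>\<close> and none of smaller degree, which
  gives minimality.

  An explicit \<open>K\<close> is good. Since \<open>det (A + \<epsilon> B)\<close> with \<open>B\<close> invertible vanishes for finitely many \<open>\<epsilon>\<close>
  only, \<open>P + \<epsilon> K\<close> is good for arbitrarily small \<open>\<epsilon>\<close>, whatever \<open>P\<close> is.\<close>

section \<open>Square linear systems\<close>

text \<open>Arbitrary index sets spare a numbering of the pairs (entry, exponent) that label
  equations and unknowns below. Solvability serves to construct null vectors, uniqueness to show
  that they span.\<close>

definition nonsingular_system :: "'i set \<Rightarrow> 'j set \<Rightarrow> ('i \<Rightarrow> 'j \<Rightarrow> complex) \<Rightarrow> bool" where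
  "nonsingular_system I J M \<longleftrightarrow>
     (\<forall>b. \<exists>x. \<forall>i\<in>I. (\<Sum>j\<in>J. M i j * x j) = b i) \<and>
     (\<forall>x. (\<forall>i\<in>I. (\<Sum>j\<in>J. M i j * x j) = 0) \<longrightarrow> (\<forall>j\<in>J. x j = 0))"

text \<open>Multiplication by the inverse C of B turns a singular A + \<epsilon> B into the
  eigenvalue - \<epsilon> of C A, and the characteristic polynomial of C A is monic, hence has
  finitely many roots.\<close>

lemma finite_singular_pencil:
  fixes A B :: "complex mat"
  assumes A: "A \<in> carrier_mat N N" and B: "B \<in> carrier_mat N N" and "det B \<noteq> 0"
  shows "finite {\<epsilon>. det (A + \<epsilon> \<cdot>\<^sub>m B) = 0}"
proof -
  obtain C where C: "C \<in> carrier_mat N N" "C * B = 1\<^sub>m N"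
    using det_non_zero_imp_unit[OF B \<open>det B \<noteq> 0\<close>] 
    unfolding Units_def ring_mat_def by auto
  have CA: "C * A \<in> carrier_mat N N" using A C by simp
  let ?p = "char_poly (C * A)"
  have "?p \<noteq> 0"
    using degree_monic_char_poly[OF CA] by auto
  have "{\<epsilon>. det (A + \<epsilon> \<cdot>\<^sub>m B) = 0} \<subseteq> uminus ` {x. poly ?p x = 0}"
  proof
    fix \<epsilon> assume "\<epsilon> \<in> {\<epsilon>. det (A + \<epsilon> \<cdot>\<^sub>m B) = 0}"
    then have "det (C * (A + \<epsilon> \<cdot>\<^sub>m B)) = 0"
      using A B C by (subst det_mult[of _ N]) auto
    also have "C * (A + \<epsilon> \<cdot>\<^sub>m B) = C * A + \<epsilon> \<cdot>\<^sub>m 1\<^sub>m N"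
      using A B C by (simp add: mult_add_distrib_mat[of _ N N _ N] mult_smult_distrib[of _ N N _ N])
    finally have "eigenvalue (C * A) (- \<epsilon>)"
      using C by (simp add: eigenvalue_det[OF CA] char_matrix_def)
    then show "\<epsilon> \<in> uminus ` {x. poly ?p x = 0}"
      using eigenvalue_root_char_poly[OF CA] by force
  qed
  then show ?thesis
    using poly_roots_finite[OF \<open>?p \<noteq> 0\<close>] finite_subset by blast
qed

text \<open>Enumerations of I and J turn the systems into N by N matrices. Since the system B is
  square, its trivial kernel makes its determinant nonzero.\<close>

lemma finite_singular_system_pencil:
  assumes fin: "finite I" "finite J" and card: "card I = card J"
    and inj: "\<And>x. (\<And>i. i \<in> I \<Longrightarrow> (\<Sum>j\<in>J. B i j * x j) = 0) \<Longrightarrow> (\<And>j. j \<in> J \<Longrightarrow> x j = 0)"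
  shows "finite {\<epsilon>. \<not> nonsingular_system I J (\<lambda>i j. A i j + \<epsilon> * B i j)}"
    and "nonsingular_system I J B"
proof -
  define N where "N = card I"
  obtain f where f: "bij_betw f {..<N} I"
    using fin N_def by (metis atLeast0LessThan ex_bij_betw_nat_finite)
  obtain g where g: "bij_betw g {..<N} J"
    using fin card N_def by (metis atLeast0LessThan ex_bij_betw_nat_finite)
  define g' where "g' = the_inv_into {..<N} g"
  have g'g: "g' (g a) = a" if "a < N" for a
    using g that by (simp add: g'_def bij_betw_def the_inv_into_f_f)
  have gg': "g (g' j) = j" "g' j < N" if "j \<in> J" for j
    using f_the_inv_into_f_bij_betw[OF g] bij_betwE[OF bij_betw_the_inv_into[OF g]] that
    unfolding g'_def by auto
  define T where "T M = mat N N (\<lambda>(a, b). M (f a) (g b))" for M :: "_ \<Rightarrow> _ \<Rightarrow> complex"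
  have T: "T M \<in> carrier_mat N N" for M by (simp add: T_def)
  have sumJ: "(\<Sum>j\<in>J. h j) = (\<Sum>b<N. h (g b))" for h :: "_ \<Rightarrow> complex"
    using sum.reindex_bij_betw[OF g, of h] by simp
  have row: "(\<Sum>j\<in>J. M (f a) j * x j) = (T M *\<^sub>v vec N (\<lambda>b. x (g b))) $ a" if "a < N" for M x a
    using that unfolding sumJ by (simp add: T_def scalar_prod_def atLeast0LessThan)
  have nonsing: "nonsingular_system I J M" if nz: "det (T M) \<noteq> 0" for M
    unfolding nonsingular_system_def
  proof (intro conjI allI impI)
    obtain C where C: "C \<in> carrier_mat N N" "T M * C = 1\<^sub>m N"
      using det_non_zero_imp_unit[OF T nz] unfolding Units_def ring_mat_def by auto
    fix b
    define f' where "f' = the_inv_into {..<N} f"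
    have ff': "f (f' i) = i" "f' i < N" if "i \<in> I" for i
      using f_the_inv_into_f_bij_betw[OF f] bij_betwE[OF bij_betw_the_inv_into[OF f]] that
      unfolding f'_def by auto
    define v where "v = C *\<^sub>v vec N (\<lambda>a. b (f a))"
    have v: "v \<in> carrier_vec N" using C by (simp add: v_def)
    have "T M *\<^sub>v v = vec N (\<lambda>a. b (f a))"
      unfolding v_def using C T[of M] by (subst assoc_mult_mat_vec[symmetric, of _ N N _ N]) auto
    moreover have "vec N (\<lambda>c. v $ g' (g c)) = v" using v g'g by auto
    ultimately have *: "(\<Sum>j\<in>J. M (f a) j * v $ g' j) = b (f a)" if "a < N" for a
      using row[OF that, of M "\<lambda>j. v $ g' j"] that by simp
    have "\<forall>i\<in>I. (\<Sum>j\<in>J. M i j * v $ g' j) = b i"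
      using *[of "f' i" for i] ff' by metis
    then show "\<exists>x. \<forall>i\<in>I. (\<Sum>j\<in>J. M i j * x j) = b i" 
      by (intro exI[of _ "\<lambda>j. v $ g' j"])
  next
    fix x assume x: "\<forall>i\<in>I. (\<Sum>j\<in>J. M i j * x j) = 0"
    have "T M *\<^sub>v vec N (\<lambda>b. x (g b)) = 0\<^sub>v N"
    proof (rule eq_vecI)
      fix a assume "a < dim_vec (0\<^sub>v N :: complex vec)"
      then have "a < N" by simp
      then show "(T M *\<^sub>v vec N (\<lambda>b. x (g b))) $ a = 0\<^sub>v N $ a"
        using x f row[of a M x] by (metis bij_betwE lessThan_iff index_zero_vec(1))
    qed (simp add: T_def)
    then have "vec N (\<lambda>b. x (g b)) = 0\<^sub>v N"
      using nz det_0_iff_vec_prod_zero_field[OF T] by (metis vec_carrier)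
    then have "x (g b) = 0" if "b < N" for b
      using that by (metis index_vec index_zero_vec(1))
    then show "\<forall>j\<in>J. x j = 0" using gg' by metis
  qed
  have B: "det (T B) \<noteq> 0"
  proof
    assume "det (T B) = 0"
    then obtain v where v: "v \<in> carrier_vec N" "v \<noteq> 0\<^sub>v N" "T B *\<^sub>v v = 0\<^sub>v N"
      using det_0_iff_vec_prod_zero_field[OF T] by blast
    have vv: "vec N (\<lambda>c. v $ g' (g c)) = v" using v g'g by auto
    have "(\<Sum>j\<in>J. B i j * v $ g' j) = 0" if i: "i \<in> I" for i
    proof -
      obtain a where "a < N" "i = f a"
        using i[folded bij_betw_imp_surj_on[OF f]] by auto
      then show ?thesis using row[of a B "\<lambda>j. v $ g' j"] v vv by simp
    qed
    then have g'0: "v $ g' j = 0" if "j \<in> J" for j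
      using inj[of "\<lambda>j. v $ g' j"] that by blast
    have "v $ b = 0" if "b < N" for b
      using g'0[of "g b"] bij_betwE[OF g] g'g[OF that] that by simp
    then show False using v by auto
  qed
  show "nonsingular_system I J B" by (rule nonsing[OF B])
  have "T (\<lambda>i j. A i j + \<epsilon> * B i j) = T A + \<epsilon> \<cdot>\<^sub>m T B" for \<epsilon>
    by (rule eq_matI) (auto simp: T_def)
  then have "{\<epsilon>. \<not> nonsingular_system I J (\<lambda>i j. A i j + \<epsilon> * B i j)} \<subseteq> {\<epsilon>. det (T A + \<epsilon> \<cdot>\<^sub>m T B) = 0}"
    using nonsing[of "\<lambda>i j. A i j + _ * B i j"] by auto
  then show "finite {\<epsilon>. \<not> nonsingular_system I J (\<lambda>i j. A i j + \<epsilon> * B i j)}"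
    using finite_singular_pencil[OF T T B] finite_subset by blast
qed

section \<open>The null vector equations\<close>

text \<open>Padding with zeros makes the range of k independent of e, so that this becomes a row of
  a linear system with a fixed set of unknowns.\<close>

lemma coeff_mult_bounded:
  fixes y p :: "'a :: comm_semiring_1 poly"
  assumes "degree y \<le> b"
  shows "coeff (y * p) e = (\<Sum>k\<le>b. (if k \<le> e then coeff p (e - k) else 0) * coeff y k)"
proof -
  have "coeff (y * p) e = (\<Sum>k\<in>{..e} \<inter> {..b}. coeff y k * coeff p (e - k))"
    unfolding coeff_mult
  proof (intro sum.mono_neutral_right ballI)
    fix i assume "i \<in> {..e} - {..e} \<inter> {..b}"
    then have "degree y < i" using assms by auto
    then show "coeff y i * coeff p (e - i) = 0" by (simp add: coeff_eq_0)
  qed auto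
  also have "\<dots> = (\<Sum>k\<le>b. (if k \<le> e then coeff p (e - k) else 0) * coeff y k)"
    by (intro sum.mono_neutral_cong_left) (auto simp: mult.commute)
  finally show ?thesis .
qed

text \<open>Entry j of the row vector y times Q. Vectors are plain functions, of which only the
  first m values matter; this spares dimension side conditions.\<close>

definition row_mult :: "nat \<Rightarrow> (nat \<Rightarrow> complex poly) \<Rightarrow> complex poly mat \<Rightarrow> nat \<Rightarrow> complex poly" where
  "row_mult m y Q j = (\<Sum>r<m. y r * Q $$ (r, j))"

lemma row_mult_diff: "row_mult m (\<lambda>r. x r - y r) Q j = row_mult m x Q j - row_mult m y Q j"
  by (simp add: row_mult_def left_diff_distrib sum_subtractf)

lemma row_mult_sum: "row_mult m (\<lambda>r. \<Sum>l\<in>L. a l * N l r) Q j = (\<Sum>l\<in>L. a l * row_mult m (N l) Q j)"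
  unfolding row_mult_def sum_distrib_right sum_distrib_left
  by (subst sum.swap) (simp add: mult.assoc)

lemma POL_degree_le: "Q \<in> POL d m n \<Longrightarrow> r < m \<Longrightarrow> j < n \<Longrightarrow> degree (Q $$ (r, j)) \<le> d"
  by (simp add: POL_def)

lemma degree_row_mult_le:
  assumes "Q \<in> POL d m n" "j < n" and "\<And>r. r < m \<Longrightarrow> degree (y r) \<le> b"
  shows "degree (row_mult m y Q j) \<le> d + b"
  unfolding row_mult_def
proof (rule degree_sum_le)
  fix r assume "r \<in> {..<m}"
  then have "degree (y r) \<le> b" "degree (Q $$ (r, j)) \<le> d"
    using assms by (auto simp: POL_def)
  then show "degree (y r * Q $$ (r, j)) \<le> d + b"
    using degree_mult_le[of "y r" "Q $$ (r, j)"] by linarith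
qed simp

lemma coeff_row_mult:
  assumes "\<And>r. r < m \<Longrightarrow> degree (y r) \<le> b"
  shows "coeff (row_mult m y Q j) e =
    (\<Sum>(r, k)\<in>{..<m} \<times> {..b}. (if k \<le> e then coeff (Q $$ (r, j)) (e - k) else 0) * coeff (y r) k)"
  unfolding row_mult_def coeff_sum sum.cartesian_product[symmetric]
  using assms by (intro sum.cong) (auto simp: coeff_mult_bounded)

section \<open>The square system for null vectors and its perturbation\<close>

locale grade_size =
  fixes m n d :: nat
  assumes n_pos: "0 < n" and d_pos: "0 < d" and n_less_m: "n < m"
begin

text \<open>The target eigenstructure has \<open>q\<close> left minimal indices: \<open>s\<close> of
  them equal \<beta> and \<open>t\<close> equal \<beta> + 1. The number \<open>s\<close> is never
  zero.\<close>

definition q where "q = m - n"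
definition \<beta> where "\<beta> = n * d div q"
definition t where "t = n * d mod q"
definition s where "s = q - t"

lemma q_add_n: "q + n = m" and q_pos: "0 < q" 
  using n_less_m by (auto simp: q_def)

lemma t_less: "t < q" and s_le: "s \<le> q" and t_eq: "t = q - s"
  using q_pos by (auto simp: t_def s_def)

lemma nd_eq: "n * d = q * \<beta> + t"
  by (simp add: \<beta>_def t_def)

text \<open>Solvability and uniqueness are stated for polynomials, so that consequences of goodness
  need no coefficient system. The last condition is about the transpose of the block of rows q, ...,
  m - 1, since null vectors multiply from the left.\<close>

definition good :: "complex poly mat \<Rightarrow> bool" where
  "good Q \<longleftrightarrow>
    (\<forall>z c. (\<forall>j<n. degree (z j) \<le> d + \<beta>) \<longrightarrow>
       (\<exists>y. (\<forall>r<m. degree (y r) \<le> \<beta>) \<and> (\<forall>j<n. row_mult m y Q j = z j) \<and>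
          (\<forall>l<s. coeff (y l) \<beta> = c l))) \<and>
    (\<forall>y. (\<forall>r<m. degree (y r) \<le> \<beta>) \<longrightarrow> (\<forall>j<n. row_mult m y Q j = 0) \<longrightarrow>
       (\<forall>l<s. coeff (y l) \<beta> = 0) \<longrightarrow> (\<forall>r<m. y r = 0)) \<and>
    nonsingular_system {..<n} {..<n} (\<lambda>j i. coeff (Q $$ (q + i, j)) d)"

text \<open>The scale \<open>c\<close> of the normalising equations makes \<open>system \<epsilon> (P + \<epsilon> K)\<close> a pencil
  \<open>system 0 P + \<epsilon> system 1 K\<close>.\<close>

definition system :: "complex \<Rightarrow> complex poly mat \<Rightarrow> (nat \<times> nat) + nat \<Rightarrow> nat \<times> nat \<Rightarrow> complex" where
  "system c Q = case_sum
     (\<lambda>(j, e) (r, k). if k \<le> e then coeff (Q $$ (r, j)) (e - k) else 0)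
     (\<lambda>l (r, k). if r = l \<and> k = \<beta> then c else 0)"

abbreviation equations where "equations \<equiv> ({..<n} \<times> {..d + \<beta>}) <+> {..<s}"
abbreviation unknowns where "unknowns \<equiv> {..<m} \<times> {..\<beta>}"

text \<open>Since n d = q \<beta> + t, the products have n (d + \<beta> + 1) = m (\<beta> + 1) - s
  coefficients; the s normalising equations supply exactly what is missing.\<close>

lemma card_equations: "card equations = card unknowns"
proof -
  have "card equations = n * (d + \<beta> + 1) + s"
    by (simp add: card_Plus card_cartesian_product)
  also have "\<dots> = n * d + n * (\<beta> + 1) + s" by (simp add: algebra_simps)
  also have "\<dots> = q * \<beta> + (t + s) + n * (\<beta> + 1)" by (simp add: nd_eq)
  also have "t + s = q" using t_less by (simp add: s_def)
  also have "q * \<beta> + q + n * (\<beta> + 1) = (q + n) * (\<beta> + 1)" by (simp add: algebra_simps)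
  finally show ?thesis by (simp add: card_cartesian_product q_add_n)
qed

lemma system_Inl:
  assumes "\<And>r. r < m \<Longrightarrow> degree (y r) \<le> \<beta>"
  shows "(\<Sum>u\<in>unknowns. system c Q (Inl (j, e)) u * (case u of (r, k) \<Rightarrow> coeff (y r) k)) =
    coeff (row_mult m y Q j) e"
  by (subst coeff_row_mult[OF assms]) (auto simp: system_def intro!: sum.cong)

lemma system_Inr:
  assumes "l < s"
  shows "(\<Sum>u\<in>unknowns. system c Q (Inr l) u * (case u of (r, k) \<Rightarrow> x r k)) = c * x l \<beta>"
proof -
  have "l < m" using assms s_le q_add_n by linarith
  then have "(l, \<beta>) \<in> unknowns" by auto
  moreover have "system c Q (Inr l) u * (case u of (r, k) \<Rightarrow> x r k) =
      (if u = (l, \<beta>) then c * x l \<beta> else 0)" for u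
    by (auto simp: system_def split: prod.splits)
  ultimately show ?thesis by simp
qed

text \<open>Passage from coefficients to polynomials: comparing coefficients up to d + \<beta> is
  enough, since both sides have at most that degree.\<close>

lemma goodI:
  assumes Q: "Q \<in> POL d m n" and c: "c \<noteq> 0"
    and sys: "nonsingular_system equations unknowns (system c Q)"
    and lead: "nonsingular_system {..<n} {..<n} (\<lambda>j i. coeff (Q $$ (q + i, j)) d)"
  shows "good Q"
  unfolding good_def
proof (intro conjI allI impI lead)
  fix z :: "nat \<Rightarrow> complex poly" and a :: "nat \<Rightarrow> complex" assume z: "\<forall>j<n. degree (z j) \<le> d + \<beta>"
  \<comment> \<open>The prescribed values are multiplied by c to match the scaled normalising
    equations; c is cancelled at the end.\<close>
  obtain x where x: "\<forall>i\<in>equations. (\<Sum>u\<in>unknowns. system c Q i u * x u) =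
      case_sum (\<lambda>(j, e). coeff (z j) e) (\<lambda>l. c * a l) i"
    using conjunct1[OF sys[unfolded nonsingular_system_def], THEN spec, of "case_sum (\<lambda>(j, e). coeff (z j) e) (\<lambda>l. c * a l)"]
    by blast
  define y where "y r = (\<Sum>k\<le>\<beta>. monom (x (r, k)) k)" for r
  have y_deg: "degree (y r) \<le> \<beta>" for r
    unfolding y_def by (rule degree_sum_le) (auto intro: order_trans[OF degree_monom_le])
  have y_coeff: "coeff (y r) k = (if k \<le> \<beta> then x (r, k) else 0)" for r k
    by (simp add: y_def coeff_sum)
  have xy: "(\<Sum>u\<in>unknowns. system c Q i u * x u) =
      (\<Sum>u\<in>unknowns. system c Q i u * (case u of (r, k) \<Rightarrow> coeff (y r) k))" for i
    by (intro sum.cong) (auto simp: y_coeff)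
  have "row_mult m y Q j = z j" if "j < n" for j
  proof (rule poly_eqI)
    fix e
    show "coeff (row_mult m y Q j) e = coeff (z j) e"
    proof (cases "e \<le> d + \<beta>")
      case True
      then have "Inl (j, e) \<in> equations" using that by auto
      then have "(\<Sum>u\<in>unknowns. system c Q (Inl (j, e)) u * x u) = coeff (z j) e"
        using bspec[OF x, of "Inl (j, e)"] by simp
      then show ?thesis
        unfolding xy using system_Inl[of y c Q j e] y_deg by simp
    next
      case False
      then show ?thesis
        using z that degree_row_mult_le[OF Q that, of y \<beta>] y_deg
        by (metis coeff_eq_0 le_less_trans not_le)
    qed
  qed
  moreover have "coeff (y l) \<beta> = a l" if "l < s" for l
  proof -
    have "(\<Sum>u\<in>unknowns. system c Q (Inr l) u * x u) = c * a l"
      using bspec[OF x, of "Inr l"] that by auto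
    then show ?thesis
      unfolding xy using system_Inr[OF that, of c Q "\<lambda>r k. coeff (y r) k"] c by simp
  qed
  ultimately show "\<exists>y. (\<forall>r<m. degree (y r) \<le> \<beta>) \<and> (\<forall>j<n. row_mult m y Q j = z j) \<and>
      (\<forall>l<s. coeff (y l) \<beta> = a l)"
    using y_deg by blast
next
  fix y r
  assume y: "\<forall>r<m. degree (y r) \<le> \<beta>" "\<forall>j<n. row_mult m y Q j = 0" "\<forall>l<s. coeff (y l) \<beta> = 0"
    and r: "r < m"
  have *: "(\<Sum>u\<in>unknowns. system c Q i u * (case u of (r, k) \<Rightarrow> coeff (y r) k)) = 0"
    if "i \<in> equations" for i
  proof (cases i)
    case (Inl a)
    then show ?thesis using that y system_Inl[of y c Q] by (cases a) auto
  next
    case (Inr l)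
    then show ?thesis using that y system_Inr[of l c Q "\<lambda>r k. coeff (y r) k"] by auto
  qed
  have **: "coeff (y r) k = 0" if "k \<le> \<beta>" for k
  proof -
    have "\<forall>u\<in>unknowns. (case u of (r, k) \<Rightarrow> coeff (y r) k) = 0"
      using sys * unfolding nonsingular_system_def by blast
    moreover have "(r, k) \<in> unknowns" using r that by simp
    ultimately show ?thesis by fastforce
  qed
  show "y r = 0"
  proof (rule poly_eqI)
    fix k show "coeff (y r) k = coeff 0 k"
      using ** y(1) r by (cases "k \<le> \<beta>") (auto simp: coeff_eq_0)
  qed
qed

text \<open>Both systems are square, so only their kernels at \<open>K\<close> have to be checked.
  Goodness of P + \<epsilon> K can then fail only where one of two pencils is singular, or at
  \<epsilon> = 0.\<close>

lemma finite_not_good_pencil: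
  assumes P: "P \<in> POL d m n" and K: "K \<in> POL d m n"
    and inj: "\<And>y. (\<And>r. r < m \<Longrightarrow> degree (y r) \<le> \<beta>) \<Longrightarrow> (\<And>j. j < n \<Longrightarrow> row_mult m y K j = 0) \<Longrightarrow>
       (\<And>l. l < s \<Longrightarrow> coeff (y l) \<beta> = 0) \<Longrightarrow> (\<And>r. r < m \<Longrightarrow> y r = 0)"
    and lead: "\<And>x. (\<And>j. j < n \<Longrightarrow> (\<Sum>i<n. coeff (K $$ (q + i, j)) d * x i) = 0) \<Longrightarrow> (\<And>i. i < n \<Longrightarrow> x i = 0)"
  shows "finite {\<epsilon>. \<not> good (P + [:\<epsilon>:] \<cdot>\<^sub>m K)}" and "good K"
proof -
  have inj': "x u = 0" if x: "\<And>i. i \<in> equations \<Longrightarrow> (\<Sum>u\<in>unknowns. system 1 K i u * x u) = 0"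
    and u: "u \<in> unknowns" for x u
  proof -
    define y where "y r = (\<Sum>k\<le>\<beta>. monom (x (r, k)) k)" for r
    have y_deg: "degree (y r) \<le> \<beta>" for r
      unfolding y_def by (rule degree_sum_le) (auto intro: order_trans[OF degree_monom_le])
    have y_coeff: "coeff (y r) k = (if k \<le> \<beta> then x (r, k) else 0)" for r k
      by (simp add: y_def coeff_sum)
    have xy: "(\<Sum>u\<in>unknowns. system 1 K i u * x u) =
        (\<Sum>u\<in>unknowns. system 1 K i u * (case u of (r, k) \<Rightarrow> coeff (y r) k))" for i
      by (intro sum.cong) (auto simp: y_coeff)
    have "y r = 0" if "r < m" for r
    proof (rule inj[OF _ _ _ that])
      fix j assume j: "j < n"
      show "row_mult m y K j = 0"
      proof (rule poly_eqI)
        fix e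
        show "coeff (row_mult m y K j) e = coeff 0 e"
        proof (cases "e \<le> d + \<beta>")
          case True
          then have "Inl (j, e) \<in> equations" using j by auto
          from x[OF this] show ?thesis
            unfolding xy using system_Inl[of y 1 K j e] y_deg by simp
        next
          case False
          then show ?thesis
            using degree_row_mult_le[OF K j, of y \<beta>] y_deg
            by (metis coeff_0 coeff_eq_0 le_less_trans not_le)
        qed
      qed
    next
      fix l assume l: "l < s"
      then have "Inr l \<in> equations" by auto
      from x[OF this] show "coeff (y l) \<beta> = 0"
        unfolding xy using system_Inr[OF l, of 1 K "\<lambda>r k. coeff (y r) k"] by simp
    qed (rule y_deg)
    then show ?thesis using u y_coeff by (metis (no_types) SigmaE atMost_iff coeff_0 lessThan_iff)
  qed
  have main: "finite {\<epsilon>. \<not> nonsingular_system equations unknowns (\<lambda>i u. system 0 P i u + \<epsilon> * system 1 K i u)}"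
    "nonsingular_system equations unknowns (system 1 K)"
    by (rule finite_singular_system_pencil[OF _ _ card_equations]; (rule inj'; assumption | simp))+
  have main': "finite {\<epsilon>. \<not> nonsingular_system {..<n} {..<n}
      (\<lambda>j i. coeff (P $$ (q + i, j)) d + \<epsilon> * coeff (K $$ (q + i, j)) d)}"
    "nonsingular_system {..<n} {..<n} (\<lambda>j i. coeff (K $$ (q + i, j)) d)"
    using lead by (intro finite_singular_system_pencil; (blast | simp))+
  show "good K"
    by (rule goodI[OF K _ main(2) main'(2)]) simp
  have PK: "P + [:\<epsilon>:] \<cdot>\<^sub>m K \<in> POL d m n" for \<epsilon>
    using P K by (auto simp: POL_def intro!: degree_add_le)
  have entry: "coeff ((P + [:\<epsilon>:] \<cdot>\<^sub>m K) $$ (r, j)) e = coeff (P $$ (r, j)) e + \<epsilon> * coeff (K $$ (r, j)) e"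
    if "r < m" "j < n" for \<epsilon> r j e
    using P K that by (auto simp: POL_def)
  have sys_eq: "nonsingular_system equations unknowns (system \<epsilon> (P + [:\<epsilon>:] \<cdot>\<^sub>m K)) =
    nonsingular_system equations unknowns (\<lambda>i u. system 0 P i u + \<epsilon> * system 1 K i u)" for \<epsilon>
  proof -
    have "system \<epsilon> (P + [:\<epsilon>:] \<cdot>\<^sub>m K) i u = system 0 P i u + \<epsilon> * system 1 K i u"
      if "i \<in> equations" "u \<in> unknowns" for i u
      using that entry by (auto simp: system_def)
    then show ?thesis unfolding nonsingular_system_def by simp
  qed
  have lead_eq: "nonsingular_system {..<n} {..<n} (\<lambda>j i. coeff ((P + [:\<epsilon>:] \<cdot>\<^sub>m K) $$ (q + i, j)) d) =
    nonsingular_system {..<n} {..<n} (\<lambda>j i. coeff (P $$ (q + i, j)) d + \<epsilon> * coeff (K $$ (q + i, j)) d)" for \<epsilon>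
  proof -
    have "q + i < m" if "i < n" for i using that q_add_n by linarith
    then show ?thesis unfolding nonsingular_system_def by (simp add: entry)
  qed
  \<comment> \<open>The value 0 is set apart because \<open>goodI\<close> requires a nonzero
    scale.\<close>
  have "{\<epsilon>. \<not> good (P + [:\<epsilon>:] \<cdot>\<^sub>m K)} \<subseteq> {0} \<union>
     {\<epsilon>. \<not> nonsingular_system equations unknowns (\<lambda>i u. system 0 P i u + \<epsilon> * system 1 K i u)} \<union>
     {\<epsilon>. \<not> nonsingular_system {..<n} {..<n}
      (\<lambda>j i. coeff (P $$ (q + i, j)) d + \<epsilon> * coeff (K $$ (q + i, j)) d)}"
    using goodI[OF PK] sys_eq lead_eq by blast
  then show "finite {\<epsilon>. \<not> good (P + [:\<epsilon>:] \<cdot>\<^sub>m K)}"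
    using main(1) main'(1) by (meson finite.emptyI finite.insertI finite_UnI finite_subset)
qed

end

section \<open>A row reduced family of null vectors\<close>

lemma sum_lessThan_add:
  fixes f :: "nat \<Rightarrow> 'a :: comm_monoid_add"
  shows "(\<Sum>r<a + b. f r) = (\<Sum>r<a. f r) + (\<Sum>i<b. f (a + i))"
  by (induction b) (simp_all add: add.assoc)

lemma coeff_row_mult_top:
  assumes "Q \<in> POL d m n" "j < n" and "\<And>r. r < m \<Longrightarrow> degree (y r) \<le> k"
  shows "coeff (row_mult m y Q j) (d + k) = (\<Sum>r<m. coeff (Q $$ (r, j)) d * coeff (y r) k)"
  unfolding row_mult_def coeff_sum
proof (rule sum.cong)
  fix r assume "r \<in> {..<m}"
  then have r: "degree (y r) \<le> k" "degree (Q $$ (r, j)) \<le> d"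
    using assms by (auto simp: POL_def)
  have "coeff (y r * Q $$ (r, j)) (d + k) =
      (\<Sum>i\<le>k. if i = k then coeff (Q $$ (r, j)) d * coeff (y r) k else 0)"
    unfolding coeff_mult_bounded[OF r(1)] using r(2)
    by (intro sum.cong) (auto simp: coeff_eq_0)
  then show "coeff (y r * Q $$ (r, j)) (d + k) = coeff (Q $$ (r, j)) d * coeff (y r) k"
    by simp
qed simp

locale good_matpoly = grade_size +
  fixes Q :: "complex poly mat"
  assumes Q_POL: "Q \<in> POL d m n" and Q_good: "good Q"
begin

text \<open>The expected minimal indices in ascending order.\<close>

definition \<eta> :: "nat \<Rightarrow> nat" where "\<eta> l = (if l < s then \<beta> else \<beta> + 1)"

lemma solvable:
  assumes "\<And>j. j < n \<Longrightarrow> degree (z j) \<le> d + \<beta>"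
  shows "\<exists>y. (\<forall>r<m. degree (y r) \<le> \<beta>) \<and> (\<forall>j<n. row_mult m y Q j = z j) \<and>
    (\<forall>l<s. coeff (y l) \<beta> = c l)"
  using assms Q_good unfolding good_def by simp

lemma unique:
  assumes "\<And>r. r < m \<Longrightarrow> degree (y r) \<le> \<beta>" and "\<And>j. j < n \<Longrightarrow> row_mult m y Q j = 0"
    and "\<And>l. l < s \<Longrightarrow> coeff (y l) \<beta> = 0" and "r < m"
  shows "y r = 0"
  using assms Q_good unfolding good_def by blast

lemma lead_solvable:
  obtains x where "\<And>j. j < n \<Longrightarrow> (\<Sum>i<n. coeff (Q $$ (q + i, j)) d * x i) = b j"
proof -
  have "nonsingular_system {..<n} {..<n} (\<lambda>j i. coeff (Q $$ (q + i, j)) d)"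
    using Q_good unfolding good_def by (elim conjE)
  from conjunct1[OF this[unfolded nonsingular_system_def], THEN spec, of b]
  show ?thesis using that by blast
qed

lemma lead_unique:
  assumes "\<And>j. j < n \<Longrightarrow> (\<Sum>i<n. coeff (Q $$ (q + i, j)) d * x i) = 0" and "i < n"
  shows "x i = 0"
proof -
  have "nonsingular_system {..<n} {..<n} (\<lambda>j i. coeff (Q $$ (q + i, j)) d)"
    using Q_good unfolding good_def by (elim conjE)
  from conjunct2[OF this[unfolded nonsingular_system_def], THEN spec, of x]
  show ?thesis using assms by blast
qed

text \<open>The coefficient of degree d + k + 1 of the product involves only top coefficients. Once
  the first q of those of y vanish, the remaining n solve the homogeneous system of the nonsingular
  block.\<close>

lemma null_leading_coeff_eq_0:
  assumes deg: "\<And>r. r < m \<Longrightarrow> degree (y r) \<le> Suc k" and null: "\<And>j. j < n \<Longrightarrow> row_mult m y Q j = 0"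
    and zero: "\<And>l. l < q \<Longrightarrow> coeff (y l) (Suc k) = 0" and r: "r < m"
  shows "degree (y r) \<le> k"
proof -
  have "coeff (y (q + i)) (Suc k) = 0" if "i < n" for i
  proof (rule lead_unique[OF _ that])
    fix j assume j: "j < n"
    have "0 = (\<Sum>r<q + n. coeff (Q $$ (r, j)) d * coeff (y r) (Suc k))"
      using coeff_row_mult_top[OF Q_POL j, of y "Suc k"] deg null[OF j] by (simp add: q_add_n)
    also have "\<dots> = (\<Sum>i<n. coeff (Q $$ (q + i, j)) d * coeff (y (q + i)) (Suc k))"
      using zero by (simp add: sum_lessThan_add)
    finally show "(\<Sum>i<n. coeff (Q $$ (q + i, j)) d * coeff (y (q + i)) (Suc k)) = 0" ..
  qed
  then have "coeff (y r) (Suc k) = 0"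
    using zero[of r] r q_add_n by (metis add_less_cancel_left le_add_diff_inverse not_le)
  then show ?thesis
    using deg[OF r] by (metis eq_zero_or_degree_less le_zero_eq less_Suc_eq_le degree_0 zero_le)
qed

lemma ex_short_null_vector:
  assumes "l < s"
  shows "\<exists>v. (\<forall>r<m. degree (v r) \<le> \<beta>) \<and> (\<forall>j<n. row_mult m v Q j = 0) \<and>
    (\<forall>l'<s. coeff (v l') \<beta> = (if l' = l then 1 else 0))"
  using solvable[of "\<lambda>_. 0" "\<lambda>l'. if l' = l then 1 else 0"] by simp

text \<open>If a constant vector c annihilates the coefficient of \<lambda>^d in Q, then c
  \<lambda>^(\<beta> + 1) has a product of degree at most d + \<beta>. Solvability gives a vector of
  degree at most \<beta> with the same product; subtracting it leaves the top coefficients c intact.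
  The nonsingular block completes any first q entries to such a c.\<close>

lemma ex_long_null_vector:
  assumes l: "l < q"
  shows "\<exists>w. (\<forall>r<m. degree (w r) \<le> \<beta> + 1) \<and> (\<forall>j<n. row_mult m w Q j = 0) \<and>
    (\<forall>l'<q. coeff (w l') (\<beta> + 1) = (if l' = l then 1 else 0))"
proof -
  obtain x where x: "\<And>j. j < n \<Longrightarrow> (\<Sum>i<n. coeff (Q $$ (q + i, j)) d * x i) = - coeff (Q $$ (l, j)) d"
    using lead_solvable[of "\<lambda>j. - coeff (Q $$ (l, j)) d"] by blast
  define c where "c r = (if r < q then if r = l then 1 else 0 else x (r - q))" for r
  define y where "y r = monom (c r) (Suc \<beta>)" for r
  have y_deg: "degree (y r) \<le> Suc \<beta>" for r by (simp add: y_def degree_monom_le)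
  have "degree (row_mult m y Q j) \<le> d + \<beta>" if j: "j < n" for j
  proof -
    have short: "(\<Sum>r<q. coeff (Q $$ (r, j)) d * c r) = coeff (Q $$ (l, j)) d"
    proof -
      have "(\<Sum>r<q. coeff (Q $$ (r, j)) d * c r) = (\<Sum>r<q. if r = l then coeff (Q $$ (r, j)) d else 0)"
        by (intro sum.cong) (auto simp: c_def)
      then show ?thesis using l by simp
    qed
    have "coeff (row_mult m y Q j) (d + Suc \<beta>) = (\<Sum>r<q + n. coeff (Q $$ (r, j)) d * c r)"
      using coeff_row_mult_top[OF Q_POL j, of y "Suc \<beta>"] y_deg by (simp add: y_def q_add_n)
    also have "\<dots> = 0"
      unfolding sum_lessThan_add short using x[OF j] by (simp add: c_def)
    finally have "coeff (row_mult m y Q j) (Suc (d + \<beta>)) = 0" by simp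
    moreover have "degree (row_mult m y Q j) \<le> Suc (d + \<beta>)"
      using degree_row_mult_le[OF Q_POL j, of y "Suc \<beta>"] y_deg by simp
    ultimately show ?thesis
      by (metis eq_zero_or_degree_less less_Suc_eq_le degree_0 zero_le)
  qed
  then have "\<exists>u. (\<forall>r<m. degree (u r) \<le> \<beta>) \<and> (\<forall>j<n. row_mult m u Q j = row_mult m y Q j) \<and>
      (\<forall>l<s. coeff (u l) \<beta> = 0)"
    by (rule solvable)
  then obtain u where u: "\<And>r. r < m \<Longrightarrow> degree (u r) \<le> \<beta>"
    "\<And>j. j < n \<Longrightarrow> row_mult m u Q j = row_mult m y Q j"
    by blast
  have "degree (y r - u r) \<le> \<beta> + 1" if "r < m" for r
    using y_deg[of r] u(1)[OF that] by (intro degree_diff_le) auto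
  moreover have "row_mult m (\<lambda>r. y r - u r) Q j = 0" if "j < n" for j
    using u(2)[OF that] by (simp add: row_mult_diff)
  moreover have "coeff (y l' - u l') (\<beta> + 1) = (if l' = l then 1 else 0)" if "l' < q" for l'
  proof -
    have "l' < m" using that q_add_n by linarith
    then have "coeff (u l') (Suc \<beta>) = 0" using u(1) by (intro coeff_eq_0) (simp add: less_Suc_eq_le)
    then show ?thesis using that by (simp add: y_def c_def)
  qed
  ultimately show ?thesis by (intro exI[of _ "\<lambda>r. y r - u r"]) blast
qed

text \<open>With row l taken at degree \<open>\<eta> l\<close>, the coefficients in the first q
  columns form a unit upper triangular matrix: short rows are normalised on the first s columns
  only, long rows on all q.\<close>

definition null_family :: "(nat \<Rightarrow> nat \<Rightarrow> complex poly) \<Rightarrow> bool" where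
  "null_family N \<longleftrightarrow>
    (\<forall>l<q. (\<forall>r<m. degree (N l r) \<le> \<eta> l) \<and> (\<forall>j<n. row_mult m (N l) Q j = 0)) \<and>
    (\<forall>l<s. \<forall>l'<s. coeff (N l l') \<beta> = (if l' = l then 1 else 0)) \<and>
    (\<forall>l<q. s \<le> l \<longrightarrow> (\<forall>l'<q. coeff (N l l') (\<beta> + 1) = (if l' = l then 1 else 0)))"

lemma ex_null_family: "\<exists>N. null_family N"
proof -
  obtain v where v: "\<And>l. l < s \<Longrightarrow> (\<forall>r<m. degree (v l r) \<le> \<beta>) \<and> (\<forall>j<n. row_mult m (v l) Q j = 0) \<and>
      (\<forall>l'<s. coeff (v l l') \<beta> = (if l' = l then 1 else 0))"
    using ex_short_null_vector by metis
  obtain w where w: "\<And>l. l < q \<Longrightarrow> (\<forall>r<m. degree (w l r) \<le> \<beta> + 1) \<and> (\<forall>j<n. row_mult m (w l) Q j = 0) \<and>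
      (\<forall>l'<q. coeff (w l l') (\<beta> + 1) = (if l' = l then 1 else 0))"
    using ex_long_null_vector by metis
  have "null_family (\<lambda>l. if l < s then v l else w l)"
    using v w s_le unfolding null_family_def \<eta>_def by auto
  then show ?thesis by blast
qed

text \<open>The bound on the coefficients \<open>a\<close> is the predictable degree property: no cancellation of
  leading terms. It survives the reversal of coefficients.\<close>

lemma null_family_spans:
  assumes N: "null_family N"
  shows "(\<And>r. r < m \<Longrightarrow> degree (y r) \<le> k) \<Longrightarrow> (\<And>j. j < n \<Longrightarrow> row_mult m y Q j = 0) \<Longrightarrow>
    \<exists>a. (\<forall>l<q. \<forall>i. k < i + \<eta> l \<longrightarrow> coeff (a l) i = 0) \<and> (\<forall>r<m. y r = (\<Sum>l<q. a l * N l r))"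
proof (induction k arbitrary: y)
  have Ndeg: "degree (N l r) \<le> \<eta> l" and Nnull: "j < n \<Longrightarrow> row_mult m (N l) Q j = 0"
    if "l < q" "r < m" for l r j
    using N that unfolding null_family_def by auto
  have Nshort: "coeff (N l l') \<beta> = (if l' = l then 1 else 0)" if "l < s" "l' < s" for l l'
    using N that unfolding null_family_def by auto
  have Nlong: "coeff (N l l') (\<beta> + 1) = (if l' = l then 1 else 0)" if "s \<le> l" "l < q" "l' < q" for l l'
    using N that unfolding null_family_def by auto
  \<comment> \<open>For k at most \<beta>, subtracting the short vectors weighted by the \<beta>-th
    coefficients of y leaves a null vector that uniqueness forces to be 0.\<close>
  have small: "\<exists>a. (\<forall>l<q. \<forall>i. k < i + \<eta> l \<longrightarrow> coeff (a l) i = 0) \<and> (\<forall>r<m. y r = (\<Sum>l<q. a l * N l r))"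
    if k: "k \<le> \<beta>" and deg: "\<And>r. r < m \<Longrightarrow> degree (y r) \<le> k"
      and null: "\<And>j. j < n \<Longrightarrow> row_mult m y Q j = 0" for y k
  proof -
    define a where "a l = (if l < s then [:coeff (y l) \<beta>:] else 0)" for l
    define y' where "y' r = y r - (\<Sum>l<q. a l * N l r)" for r
    have sum_s: "(\<Sum>l<q. a l * N l r) = (\<Sum>l<s. smult (coeff (y l) \<beta>) (N l r))" for r
      using s_le by (intro sum.mono_neutral_cong_right) (auto simp: a_def)
    have "y' r = 0" if "r < m" for r
    proof (rule unique[OF _ _ _ that])
      fix r assume r: "r < m"
      have "degree (smult c (N l r)) \<le> \<beta>" if "l < s" for l c
        using Ndeg[of l r] that s_le r by (intro order_trans[OF degree_smult_le]) (auto simp: \<eta>_def)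
      then show "degree (y' r) \<le> \<beta>"
        unfolding y'_def sum_s using deg[OF r] k
        by (intro degree_diff_le degree_sum_le) auto
    next
      fix j assume "j < n"
      then show "row_mult m y' Q j = 0"
        unfolding y'_def row_mult_diff row_mult_sum using null Nnull[of _ 0 j] n_less_m by simp
    next
      fix l' assume l': "l' < s"
      have "coeff (\<Sum>l<s. smult (coeff (y l) \<beta>) (N l l')) \<beta> = (\<Sum>l<s. if l' = l then coeff (y l) \<beta> else 0)"
        unfolding coeff_sum using Nshort l' by (intro sum.cong) auto
      then show "coeff (y' l') \<beta> = 0"
        unfolding y'_def sum_s using l' by simp
    qed
    then have "\<forall>r<m. y r = (\<Sum>l<q. a l * N l r)" by (simp add: y'_def)
    moreover have "coeff (a l) i = 0" if "l < q" "k < i + \<eta> l" for l i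
    proof (cases "l < s \<and> i = 0")
      case True
      then have "degree (y l) < \<beta>"
        using that deg[of l] q_add_n by (fastforce simp: \<eta>_def)
      then show ?thesis using True by (simp add: a_def coeff_eq_0)
    next
      case False
      then show ?thesis by (auto simp: a_def coeff_eq_0)
    qed
    ultimately show ?thesis by blast
  qed
  {
    case 0
    then show ?case using small[of 0 y] by auto
  next
    case (Suc k)
    show ?case
    proof (cases "Suc k \<le> \<beta>")
      case True
      then show ?thesis using small[of "Suc k" y] Suc.prems by auto
    next
      case False
      then have k: "\<beta> \<le> k" by simp
      \<comment> \<open>Elimination in two passes: short vectors clear the coefficients of degree k
        + 1 in the first s entries, then long vectors those in entries s to q - 1. The second pass
        does not disturb the first s entries, where long vectors have no coefficient of degree
        \<beta> + 1.\<close>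
      define a1 where "a1 l = (if l < s then monom (coeff (y l) (Suc k)) (Suc k - \<beta>) else 0)" for l
      define y1 where "y1 r = y r - (\<Sum>l<q. a1 l * N l r)" for r
      define a2 where "a2 l = (if l < s then 0 else monom (coeff (y1 l) (Suc k)) (k - \<beta>))" for l
      define y2 where "y2 r = y1 r - (\<Sum>l<q. a2 l * N l r)" for r
      have a_deg: "degree (a * N l r) \<le> Suc k" if "l < q" "r < m" "a = a1 l \<or> a = a2 l" for l r a
      proof (cases "a = 0")
        case False
        then have "degree a + \<eta> l \<le> Suc k"
          using that k by (auto simp: a1_def a2_def \<eta>_def degree_monom_eq split: if_splits)
        then show ?thesis
          using degree_mult_le[of a "N l r"] Ndeg[of l r] that by linarith
      qed simp
      have y1_deg: "degree (y1 r) \<le> Suc k" if "r < m" for r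
        unfolding y1_def using that Suc.prems(1) a_deg
        by (intro degree_diff_le degree_sum_le) auto
      have y2_deg: "degree (y2 r) \<le> Suc k" if "r < m" for r
        unfolding y2_def using that y1_deg a_deg
        by (intro degree_diff_le degree_sum_le) auto
      have y2_null: "row_mult m y2 Q j = 0" if "j < n" for j
        unfolding y2_def y1_def row_mult_diff row_mult_sum
        using that Suc.prems(2) Nnull[of _ 0 j] n_less_m by simp
      have y1_0: "coeff (y1 l') (Suc k) = 0" if "l' < s" for l'
      proof -
        have "coeff (\<Sum>l<q. a1 l * N l l') (Suc k) = (\<Sum>l<q. if l' = l then coeff (y l) (Suc k) else 0)"
          unfolding coeff_sum using Nshort that k
          by (intro sum.cong) (auto simp: a1_def coeff_monom_mult)
        then show ?thesis using that s_le by (simp add: y1_def)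
      qed
      have y2_0: "coeff (y2 l') (Suc k) = 0" if "l' < q" for l'
      proof -
        have "coeff (\<Sum>l<q. a2 l * N l l') (Suc k) = (\<Sum>l<q. if l' = l then coeff (y1 l) (Suc k) else 0)"
          unfolding coeff_sum using Nlong that k y1_0
          by (intro sum.cong) (auto simp: a2_def coeff_monom_mult Suc_diff_le)
        then show ?thesis using that by (simp add: y2_def)
      qed
      have "degree (y2 r) \<le> k" if "r < m" for r
        using null_leading_coeff_eq_0[OF y2_deg y2_null y2_0 that] .
      from Suc.IH[OF this y2_null] obtain a3 where
        a3: "\<And>l i. l < q \<Longrightarrow> k < i + \<eta> l \<Longrightarrow> coeff (a3 l) i = 0" "\<And>r. r < m \<Longrightarrow> y2 r = (\<Sum>l<q. a3 l * N l r)"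
        by auto
      define a where "a l = a1 l + a2 l + a3 l" for l
      have "y r = (\<Sum>l<q. a l * N l r)" if "r < m" for r
      proof -
        have "y r = (\<Sum>l<q. a1 l * N l r) + (\<Sum>l<q. a2 l * N l r) + (\<Sum>l<q. a3 l * N l r)"
          unfolding a3(2)[OF that, symmetric] y2_def y1_def by simp
        then show ?thesis by (simp add: a_def distrib_right sum.distrib)
      qed
      moreover have "coeff (a l) i = 0" if "l < q" "Suc k < i + \<eta> l" for l i
        using that k a3(1)[of l i] by (auto simp: a_def a1_def a2_def \<eta>_def)
      ultimately show ?thesis by blast
    qed
  }
qed

lemma null_family_generates:
  assumes N: "null_family N" and null: "\<And>j. j < n \<Longrightarrow> row_mult m y Q j = 0"
  shows "\<exists>a. \<forall>r<m. y r = (\<Sum>l<q. a l * N l r)"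
proof -
  have "degree (y r) \<le> (\<Sum>r<m. degree (y r))" if "r < m" for r
    using that by (intro member_le_sum) auto
  from null_family_spans[OF N this null] show ?thesis by blast
qed

end

section \<open>Reversal and unimodular completion\<close>

lemma coeff_rev_poly: "coeff (rev_poly d p) i = (if i \<le> d then coeff p (d - i) else 0)"
  by (simp add: rev_poly_def coeff_sum)

lemma degree_rev_poly_le: "degree (rev_poly d p) \<le> d"
  by (rule degree_le) (simp add: coeff_rev_poly)

lemma rev_poly_rev_poly: "degree p \<le> d \<Longrightarrow> rev_poly d (rev_poly d p) = p"
  by (rule poly_eqI) (simp add: coeff_rev_poly coeff_eq_0)

lemma rev_poly_0 [simp]: "rev_poly d 0 = 0"
  by (rule poly_eqI) (simp add: coeff_rev_poly)

lemma rev_poly_monom: "rev_poly d (monom 1 d) = 1"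
  by (rule poly_eqI) (auto simp: coeff_rev_poly)

lemma rev_poly_sum: "rev_poly d (\<Sum>x\<in>X. f x) = (\<Sum>x\<in>X. rev_poly d (f x))"
  by (rule poly_eqI) (simp add: coeff_rev_poly coeff_sum)

lemma rev_poly_reflect_poly:
  "degree p \<le> d \<Longrightarrow> rev_poly d p = monom 1 (d - degree p) * reflect_poly p"
  by (rule poly_eqI) (auto simp: coeff_rev_poly coeff_monom_mult coeff_reflect_poly coeff_eq_0)

text \<open>Deduced from multiplicativity of \<open>reflect_poly\<close>: the powers of \<lambda>
  that pad p and r to their grades multiply to the padding of the product, as degrees add for
  nonzero factors.\<close>

lemma rev_poly_mult:
  assumes "degree p \<le> a" and "degree r \<le> b"
  shows "rev_poly (a + b) (p * r) = rev_poly a p * rev_poly b r"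
proof (cases "p = 0 \<or> r = 0")
  case False
  then have "degree (p * r) = degree p + degree r" by (simp add: degree_mult_eq)
  then have "a + b - degree (p * r) = (a - degree p) + (b - degree r)" "degree (p * r) \<le> a + b"
    using assms by auto
  moreover have "monom (1 :: complex) (a - degree p + (b - degree r)) =
      monom 1 (a - degree p) * monom 1 (b - degree r)"
    by (simp add: mult_monom)
  ultimately show ?thesis
    using assms by (simp only: rev_poly_reflect_poly reflect_poly_mult ac_simps)
qed auto

lemma rev_mat_carrier: "Q \<in> carrier_mat m n \<Longrightarrow> rev_mat d Q \<in> carrier_mat m n"
  by (simp add: rev_mat_def)

text \<open>Null vectors and left inverses are carried between \<open>Q\<close> and its reversal by
  this identity.\<close>

lemma row_mult_rev:
  assumes Q: "Q \<in> POL d m n" and j: "j < n" and y: "\<And>r. r < m \<Longrightarrow> degree (y r) \<le> k"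
  shows "row_mult m (\<lambda>r. rev_poly k (y r)) (rev_mat d Q) j = rev_poly (d + k) (row_mult m y Q j)"
  unfolding row_mult_def rev_poly_sum
proof (rule sum.cong)
  fix r assume "r \<in> {..<m}"
  then have r: "r < m" by simp
  have "rev_mat d Q $$ (r, j) = rev_poly d (Q $$ (r, j))"
    using Q r j by (auto simp: POL_def rev_mat_def)
  then show "rev_poly k (y r) * rev_mat d Q $$ (r, j) = rev_poly (d + k) (y r * Q $$ (r, j))"
    using rev_poly_mult[OF y[OF r] POL_degree_le[OF Q r j]] by (simp add: add.commute)
qed simp

context good_matpoly
begin

text \<open>A null vector of the reversal is reversed, expanded in N and reversed back. Each summand
  can be reversed factor by factor at grade k because \<open>null_family_spans\<close> bounds the
  degree of \<open>a l\<close> by k - \<open>\<eta> l\<close>.\<close>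

lemma rev_null_family_spans:
  assumes N: "null_family N" and null: "\<And>j. j < n \<Longrightarrow> row_mult m y (rev_mat d Q) j = 0"
  shows "\<exists>a. \<forall>r<m. y r = (\<Sum>l<q. a l * rev_poly (\<eta> l) (N l r))"
proof -
  define k where "k = (\<Sum>r<m. degree (y r))"
  have y_deg: "degree (y r) \<le> k" if "r < m" for r
    unfolding k_def using that by (intro member_le_sum) auto
  define y' where "y' r = rev_poly k (y r)" for r
  have y'_deg: "degree (y' r) \<le> k" for r by (simp add: y'_def degree_rev_poly_le)
  have "row_mult m y' Q j = 0" if "j < n" for j
  proof -
    have "rev_poly (d + k) (row_mult m y' Q j) = row_mult m (\<lambda>r. rev_poly k (y' r)) (rev_mat d Q) j"
      using row_mult_rev[OF Q_POL that y'_deg] by simp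
    also have "\<dots> = row_mult m y (rev_mat d Q) j"
      unfolding row_mult_def using y_deg by (intro sum.cong) (auto simp: y'_def rev_poly_rev_poly)
    finally have "rev_poly (d + k) (row_mult m y' Q j) = 0" using null[OF that] by simp
    then show ?thesis
      using rev_poly_rev_poly[OF degree_row_mult_le[OF Q_POL that], of y' k] y'_deg by simp
  qed
  then obtain a where a: "\<And>l i. l < q \<Longrightarrow> k < i + \<eta> l \<Longrightarrow> coeff (a l) i = 0"
    "\<And>r. r < m \<Longrightarrow> y' r = (\<Sum>l<q. a l * N l r)"
    using null_family_spans[OF N, of y' k] y'_deg by blast
  define b where "b l = rev_poly (k - \<eta> l) (a l)" for l
  have "y r = (\<Sum>l<q. b l * rev_poly (\<eta> l) (N l r))" if r: "r < m" for r
  proof -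
    have "y r = rev_poly k (y' r)" using y_deg[OF r] by (simp add: y'_def rev_poly_rev_poly)
    also have "\<dots> = (\<Sum>l<q. rev_poly k (a l * N l r))" using a(2)[OF r] by (simp add: rev_poly_sum)
    also have "\<dots> = (\<Sum>l<q. b l * rev_poly (\<eta> l) (N l r))"
    proof (rule sum.cong)
      fix l assume "l \<in> {..<q}"
      then have l: "l < q" by simp
      show "rev_poly k (a l * N l r) = b l * rev_poly (\<eta> l) (N l r)"
      proof (cases "\<eta> l \<le> k")
        case True
        have "degree (a l) \<le> k - \<eta> l" using a(1)[OF l] by (intro degree_le) auto
        moreover have "degree (N l r) \<le> \<eta> l" using N l r by (simp add: null_family_def)
        ultimately show ?thesis
          using True rev_poly_mult[of "a l" "k - \<eta> l" "N l r" "\<eta> l"] by (simp add: b_def)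
      next
        \<comment> \<open>No generator with \<open>\<eta> l\<close> > k can occur.\<close>
        case False
        then have "a l = 0" using a(1)[OF l] by (intro poly_eqI) auto
        then show ?thesis by (simp add: b_def)
      qed
    qed simp
    finally show ?thesis .
  qed
  then show ?thesis by blast
qed

lemma ex_left_inverse:
  "\<exists>L. \<forall>i<n. \<forall>j<n. row_mult m (L i) Q j = (if i = j then 1 else 0)"
proof -
  have "\<exists>y. \<forall>j<n. row_mult m y Q j = (if i = j then 1 else 0)" for i
  proof -
    have "\<exists>y. (\<forall>r<m. degree (y r) \<le> \<beta>) \<and> (\<forall>j<n. row_mult m y Q j = (if i = j then 1 else 0)) \<and>
        (\<forall>l<s. coeff (y l) \<beta> = 0)"
      by (rule solvable) simp
    then show ?thesis by blast
  qed
  then show ?thesis by metis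
qed

text \<open>The right hand side \<lambda>^(d + \<beta>), of the highest degree that solvability
  allows, reverses to 1.\<close>

lemma ex_rev_left_inverse:
  "\<exists>L. \<forall>i<n. \<forall>j<n. row_mult m (L i) (rev_mat d Q) j = (if i = j then 1 else 0)"
proof -
  have "\<exists>y. \<forall>j<n. row_mult m y (rev_mat d Q) j = (if i = j then 1 else 0)" for i
  proof -
    have "\<exists>y. (\<forall>r<m. degree (y r) \<le> \<beta>) \<and>
        (\<forall>j<n. row_mult m y Q j = (if i = j then monom 1 (d + \<beta>) else 0)) \<and> (\<forall>l<s. coeff (y l) \<beta> = 0)"
      by (rule solvable) (simp add: degree_monom_le)
    then obtain y where y: "\<And>r. r < m \<Longrightarrow> degree (y r) \<le> \<beta>"
      "\<And>j. j < n \<Longrightarrow> row_mult m y Q j = (if i = j then monom 1 (d + \<beta>) else 0)" by blast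
    have "row_mult m (\<lambda>r. rev_poly \<beta> (y r)) (rev_mat d Q) j = (if i = j then 1 else 0)" if "j < n" for j
      using row_mult_rev[OF Q_POL that, of y \<beta>] y that by (simp add: rev_poly_monom)
    then show ?thesis by blast
  qed
  then show ?thesis by metis
qed

end

text \<open>For each i, the i-th unit row minus the combination of the rows of L with the
  coefficients from row i of A annihilates A, so it is a combination of the rows of N. The left
  inverse W of U is A extended by the coefficients of these combinations.\<close>

lemma ex_unimodular_completion:
  fixes A :: "complex poly mat"
  assumes A: "A \<in> carrier_mat m n" and m: "m = n + q"
    and L: "\<And>i j. i < n \<Longrightarrow> j < n \<Longrightarrow> row_mult m (L i) A j = (if i = j then 1 else 0)"
    and N: "\<And>l j. l < q \<Longrightarrow> j < n \<Longrightarrow> row_mult m (N l) A j = 0"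
    and span: "\<And>y. (\<And>j. j < n \<Longrightarrow> row_mult m y A j = 0) \<Longrightarrow> \<exists>a. \<forall>r<m. y r = (\<Sum>l<q. a l * N l r)"
  defines "U \<equiv> mat m m (\<lambda>(i, r). if i < n then L i r else N (i - n) r)"
  shows "U * A = mat m n (\<lambda>(i, j). if i = j then 1 else 0)" and "\<exists>W \<in> carrier_mat m m. W * U = 1\<^sub>m m"
proof -
  show "U * A = mat m n (\<lambda>(i, j). if i = j then 1 else 0)"
  proof (rule eq_matI)
    fix i j assume "i < dim_row (mat m n (\<lambda>(i, j). if i = j then 1 else 0))"
      "j < dim_col (mat m n (\<lambda>(i, j). if i = j then 1 else 0))"
    then have ij: "i < m" "j < n" by auto
    have "(U * A) $$ (i, j) = row_mult m (if i < n then L i else N (i - n)) A j"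
      using ij A by (auto simp: U_def scalar_prod_def row_mult_def atLeast0LessThan intro!: sum.cong)
    also have "\<dots> = (if i = j then 1 else 0)"
      using ij L[of i j] N[of "i - n" j] m by auto
    finally show "(U * A) $$ (i, j) = mat m n (\<lambda>(i, j). if i = j then 1 else 0) $$ (i, j)"
      using ij by simp
  qed (use A in \<open>auto simp: U_def\<close>)
  have "\<exists>a. \<forall>r<m. (if r = i then 1 else 0) =
      (\<Sum>j<n. A $$ (i, j) * L j r) + (\<Sum>l<q. a l * N l r)" if i: "i < m" for i
  proof -
    define y :: "nat \<Rightarrow> complex poly" where "y r = (if r = i then 1 else 0)" for r
    have y: "row_mult m y A j = A $$ (i, j)" for j
    proof -
      have "row_mult m y A j = (\<Sum>r<m. if r = i then A $$ (r, j) else 0)"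
        unfolding row_mult_def by (intro sum.cong) (auto simp: y_def)
      then show ?thesis using i by simp
    qed
    have "row_mult m (\<lambda>r. y r - (\<Sum>j<n. A $$ (i, j) * L j r)) A k = 0" if k: "k < n" for k
    proof -
      have "(\<Sum>j<n. A $$ (i, j) * row_mult m (L j) A k) = (\<Sum>j<n. if j = k then A $$ (i, j) else 0)"
        using L k by (intro sum.cong) auto
      then show ?thesis unfolding row_mult_diff row_mult_sum y using k by simp
    qed
    from span[OF this] show ?thesis unfolding y_def by (simp add: diff_eq_eq add.commute)
  qed
  then have "\<forall>i. \<exists>a. i < m \<longrightarrow> (\<forall>r<m. (if r = i then 1 else 0) =
      (\<Sum>j<n. A $$ (i, j) * L j r) + (\<Sum>l<q. a l * N l r))" by blast
  from choice[OF this] obtain a where a: "\<And>i r. i < m \<Longrightarrow> r < m \<Longrightarrow> (if r = i then 1 else 0) =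
      (\<Sum>j<n. A $$ (i, j) * L j r) + (\<Sum>l<q. a i l * N l r)" by blast
  define W where "W = mat m m (\<lambda>(i, c). if c < n then A $$ (i, c) else a i (c - n))"
  have "W * U = 1\<^sub>m m"
  proof (rule eq_matI)
    fix i r assume "i < dim_row (1\<^sub>m m :: complex poly mat)" "r < dim_col (1\<^sub>m m :: complex poly mat)"
    then have ir: "i < m" "r < m" by auto
    have "(W * U) $$ (i, r) = (\<Sum>c<n + q. W $$ (i, c) * U $$ (c, r))"
      using ir m by (simp add: W_def U_def scalar_prod_def atLeast0LessThan)
    also have "\<dots> = (\<Sum>j<n. A $$ (i, j) * L j r) + (\<Sum>l<q. a i l * N l r)"
      unfolding sum_lessThan_add using ir m
      by (intro arg_cong2[of _ _ _ _ "(+)"] sum.cong) (auto simp: W_def U_def)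
    also have "\<dots> = 1\<^sub>m m $$ (i, r)" using a[OF ir] ir by (auto split: if_splits)
    finally show "(W * U) $$ (i, r) = 1\<^sub>m m $$ (i, r)" .
  qed (auto simp: W_def U_def)
  then show "\<exists>W \<in> carrier_mat m m. W * U = 1\<^sub>m m"
    by (intro bexI[of _ W]) (auto simp: W_def)
qed

section \<open>Unimodular reduction and the Smith form\<close>

lemma unimodular_if_left_inverse:
  assumes U: "U \<in> carrier_mat k k" and W: "W \<in> carrier_mat k k" and "W * U = 1\<^sub>m k"
  shows "unimodular k U"
proof -
  have "det W * det U = 1" using det_mult[OF W U] assms by simp
  then have "det U dvd 1" by (metis dvd_triv_right)
  then obtain c where "det U = [:c:]" "c dvd 1" using is_unit_poly_iff by blast
  then show ?thesis unfolding unimodular_def using U by (intro conjI exI[of _ c]) auto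
qed

lemma mult_mat_unit_vec:
  assumes "A \<in> carrier_mat nr nc" and "j < nc"
  shows "A *\<^sub>v unit_vec nc j = (col A j :: 'a :: semiring_1 vec)"
proof (rule eq_vecI)
  fix i assume "i < dim_vec (col A j)"
  then show "(A *\<^sub>v unit_vec nc j) $ i = col A j $ i"
    using assms by (simp add: scalar_prod_right_unit)
qed (use assms in auto)

text \<open>The columns enter as a set, so distinctness matters: equal columns would put a
  difference of unit vectors into the kernel.\<close>

lemma (in vec_space) inj_mat_cols:
  assumes B: "B \<in> carrier_mat n nc"
    and inj: "\<And>v. v \<in> carrier_vec nc \<Longrightarrow> B *\<^sub>v v = 0\<^sub>v n \<Longrightarrow> v = 0\<^sub>v nc"
  shows "distinct (cols B)" and "lin_indpt (set (cols B))"
proof -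
  show dist: "distinct (cols B)"
    unfolding distinct_conv_nth
  proof (intro allI impI notI)
    fix i j assume ij: "i < length (cols B)" "j < length (cols B)" "i \<noteq> j" "cols B ! i = cols B ! j"
    then have ij': "i < nc" "j < nc" "col B i = col B j" using B by auto
    have "B *\<^sub>v (unit_vec nc i - unit_vec nc j) = col B i - col B j"
      using B ij' by (simp add: mult_minus_distrib_mat_vec[OF B] mult_mat_unit_vec)
    also have "\<dots> = 0\<^sub>v n" using B ij' by auto
    finally have "unit_vec nc i - unit_vec nc j = (0\<^sub>v nc :: 'a vec)"
      by (intro inj) auto
    then have "(unit_vec nc i - unit_vec nc j :: 'a vec) $ i = 0" using ij' by simp
    then show False using ij' ij by simp
  qed
  show "lin_indpt (set (cols B))"
    using lin_depE[OF B _ dist] inj by metis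
qed

text \<open>With V the identity matrix, U A V is already in Smith form. Over the rational functions,
  U A also shows that A has trivial kernel, hence n independent columns.\<close>

lemma smith_invariants_left_invertible:
  fixes A :: "complex poly mat"
  assumes A: "A \<in> carrier_mat m n"
    and U: "U \<in> carrier_mat m m" and UA: "U * A = mat m n (\<lambda>(i, j). if i = j then 1 else 0)"
    and W: "W \<in> carrier_mat m m" "W * U = 1\<^sub>m m" and nm: "n \<le> m"
  shows "normal_rank A = n" and "smith_invariants A (replicate n 1)"
    and "mat_kernel (to_rational_mat A) = {0\<^sub>v n}"
proof -
  interpret vec_space "TYPE(complex poly fract)" m .
  let ?A = "to_rational_mat A" and ?U = "to_rational_mat U"
  have A': "?A \<in> carrier_mat m n" and U': "?U \<in> carrier_mat m m" using A U by auto
  have UA': "?U * ?A = mat m n (\<lambda>(i, j). if i = j then 1 else 0)"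
    by (subst to_fract_hom.mat_hom_mult[OF U A, symmetric], subst UA) (rule eq_matI, auto)
  have inj: "v = 0\<^sub>v n" if v: "v \<in> carrier_vec n" "?A *\<^sub>v v = 0\<^sub>v m" for v
  proof (rule eq_vecI)
    fix i assume "i < dim_vec (0\<^sub>v n :: complex poly fract vec)"
    then have i: "i < n" by simp
    have "(?U * ?A) *\<^sub>v v = 0\<^sub>v m"
      using assoc_mult_mat_vec[OF U' A' v(1)] v(2) U' by (auto intro!: eq_vecI)
    then have "((?U * ?A) *\<^sub>v v) $ i = 0" using i nm by simp
    also have "((?U * ?A) *\<^sub>v v) $ i = (\<Sum>j<n. if j = i then v $ j else 0)"
      unfolding UA' using i nm v
      by (simp add: scalar_prod_def atLeast0LessThan if_distrib[of "\<lambda>x. x * _"] cong: if_cong)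
    finally show "v $ i = 0\<^sub>v n $ i" using i by simp
  qed (use v in auto)
  show kernel: "mat_kernel ?A = {0\<^sub>v n}"
    using inj A' by (auto simp: mat_kernel[OF A'])
  have "rank ?A = n"
    using inj_mat_cols[OF A' inj] lin_indpt_full_rank[OF A'] by blast
  then show rank: "normal_rank A = n" using A by (simp add: normal_rank_def)
  have "U * A * 1\<^sub>m n = mat m n (\<lambda>(i, j). if i = j \<and> i < length (replicate n (1 :: complex poly)) then replicate n 1 ! i else 0)"
    unfolding UA by (subst right_mult_one_mat) (auto intro!: eq_matI)
  moreover have "unimodular n (1\<^sub>m n)"
    by (rule unimodular_if_left_inverse[of _ _ "1\<^sub>m n"]) auto
  ultimately have "\<exists>U V. unimodular (dim_row A) U \<and> unimodular (dim_col A) V \<and> U * A * V =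
      mat (dim_row A) (dim_col A) (\<lambda>(i, j). if i = j \<and> i < length (replicate n (1 :: complex poly))
        then replicate n 1 ! i else 0)"
    using A unimodular_if_left_inverse[OF U W] by (intro exI[of _ U] exI[of _ "1\<^sub>m n"]) simp
  then show "smith_invariants A (replicate n 1)"
    unfolding smith_invariants_def using rank by simp
qed

lemma elementary_divisors_replicate_1: "elementary_divisors_at (replicate n 1) = (\<lambda>_. {#})"
  by (rule ext) (simp add: elementary_divisors_at_def)

section \<open>Left minimal indices\<close>

lemma kernel_basis_of_cols:
  fixes A :: "'a :: field mat"
  assumes A: "A \<in> carrier_mat nr nc" and B: "B \<in> carrier_mat nc k"
    and AB: "\<And>z. z \<in> carrier_vec k \<Longrightarrow> A *\<^sub>v (B *\<^sub>v z) = 0\<^sub>v nr"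
    and gen: "\<And>v. v \<in> mat_kernel A \<Longrightarrow> \<exists>z \<in> carrier_vec k. v = B *\<^sub>v z"
    and inj: "\<And>z. z \<in> carrier_vec k \<Longrightarrow> B *\<^sub>v z = 0\<^sub>v nc \<Longrightarrow> z = 0\<^sub>v k"
  shows "kernel.basis nc A (set (cols B))" and "distinct (cols B)"
proof -
  interpret kernel nr nc A using A by unfold_locales
  show dist: "distinct (cols B)" using NC.inj_mat_cols[OF B inj] by blast
  have sub: "set (cols B) \<subseteq> mat_kernel A"
  proof
    fix v assume "v \<in> set (cols B)"
    then obtain j where "j < k" "v = col B j" using B by (auto simp: cols_def)
    then have "v = B *\<^sub>v unit_vec k j" using mult_mat_unit_vec[OF B] by simp
    then show "v \<in> mat_kernel A" using AB[of "unit_vec k j"] B by (intro mat_kernelI[OF A]) auto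
  qed
  have "lin_indpt (set (cols B))"
    using NC.inj_mat_cols[OF B inj] lindep_same[OF sub] by blast
  moreover have "span (set (cols B)) = mat_kernel A"
  proof
    show "span (set (cols B)) \<subseteq> mat_kernel A"
      using Ker.span_is_subset2[of "set (cols B)"] sub by simp
    show "mat_kernel A \<subseteq> span (set (cols B))"
    proof
      fix v assume "v \<in> mat_kernel A"
      then obtain z where z: "z \<in> carrier_vec k" "v = B *\<^sub>v z" using gen by blast
      have "v = NC.lincomb (\<lambda>a. z $ find_first a (cols B)) (set (cols B))"
        using NC.lincomb_eq_mat_mult[OF B z(1) dist] z(2) by simp
      then show "v \<in> span (set (cols B))"
        unfolding span_same[OF sub] NC.span_def by auto
    qed
  qed
  ultimately show "basis (set (cols B))"
    unfolding Ker.basis_def using sub by simp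
qed

text \<open>A consequence of the Steinitz exchange lemma.\<close>

lemma (in kernel) card_le_if_in_span:
  assumes "finite X" and "lin_indpt X" and "finite S" and "S \<subseteq> mat_kernel A" and "X \<subseteq> span S"
  shows "card X \<le> card S"
proof -
  obtain C :: "'a vec set" where "int (card C) \<le> int (card S) - int (card X)"
    using Ker.replacement[OF assms(1,3,4,2,5)] by blast
  then show ?thesis by linarith
qed

text \<open>After the change of variables v = U^T x, with U^T invertible, the equation A^T v = 0
  says that the first n entries of x vanish. The kernel therefore consists of the combinations of
  the last q rows of U, which are the \<open>N l\<close>.\<close>

lemma left_kernel_basis:
  fixes A :: "complex poly mat"
  assumes A: "A \<in> carrier_mat m n" and m: "m = n + q"
    and U: "U = mat m m (\<lambda>(i, r). if i < n then L i r else N (i - n) r)"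
    and UA: "U * A = mat m n (\<lambda>(i, j). if i = j then 1 else 0)"
    and W: "W \<in> carrier_mat m m" "W * U = 1\<^sub>m m"
  defines "B \<equiv> mat m q (\<lambda>(r, l). to_fract (N l r))"
  shows "kernel.basis m (transpose_mat (to_rational_mat A)) (set (cols B))" and "distinct (cols B)"
proof -
  let ?A = "to_rational_mat A" and ?U = "to_rational_mat U" and ?W = "to_rational_mat W"
  have Uc: "U \<in> carrier_mat m m" by (simp add: U)
  have A': "?A \<in> carrier_mat m n" and U': "?U \<in> carrier_mat m m" and W': "?W \<in> carrier_mat m m"
    using A Uc W by auto
  have B: "B \<in> carrier_mat m q" by (simp add: B_def)
  have UA': "?U * ?A = mat m n (\<lambda>(i, j). if i = j then 1 else 0)"
    by (subst to_fract_hom.mat_hom_mult[OF Uc A, symmetric], subst UA) (rule eq_matI, auto)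
  have WU: "?W * ?U = 1\<^sub>m m"
    by (subst to_fract_hom.mat_hom_mult[OF W(1) Uc, symmetric], subst W(2)) (rule eq_matI, auto)
  have UW: "?U * ?W = 1\<^sub>m m" using mat_mult_left_right_inverse[OF W' U' WU] .
  have UW_T: "transpose_mat ?U * transpose_mat ?W = 1\<^sub>m m"
    using transpose_mult[OF W' U'] WU by simp
  have WU_T: "transpose_mat ?W * transpose_mat ?U = 1\<^sub>m m"
    using transpose_mult[OF U' W'] UW by simp
  \<comment> \<open>Coordinates x of a kernel element: n zeros in front of the q free
    entries.\<close>
  define pad where "pad z = vec m (\<lambda>i. if i < n then 0 else z $ (i - n))" for z :: "complex poly fract vec"
  have pad_carrier: "pad z \<in> carrier_vec m" for z by (simp add: pad_def)
  have U_pad: "transpose_mat ?U *\<^sub>v pad z = B *\<^sub>v z" if z: "z \<in> carrier_vec q" for z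
  proof (rule eq_vecI)
    fix r assume "r < dim_vec (B *\<^sub>v z)"
    then have r: "r < m" by (simp add: B_def)
    have "(transpose_mat ?U *\<^sub>v pad z) $ r = (\<Sum>i<n + q. ?U $$ (i, r) * pad z $ i)"
      using r Uc pad_carrier[of z] by (simp add: scalar_prod_def atLeast0LessThan m)
    also have "\<dots> = (\<Sum>l<q. to_fract (N l r) * z $ l)"
      unfolding sum_lessThan_add using r m by (simp add: U pad_def)
    also have "\<dots> = (B *\<^sub>v z) $ r"
      using r z by (simp add: B_def scalar_prod_def atLeast0LessThan)
    finally show "(transpose_mat ?U *\<^sub>v pad z) $ r = (B *\<^sub>v z) $ r" .
  qed (use Uc B in auto)
  have AU: "(transpose_mat ?A *\<^sub>v (transpose_mat ?U *\<^sub>v x)) $ j = x $ j"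
    if x: "x \<in> carrier_vec m" and j: "j < n" for x j
  proof -
    have "transpose_mat ?A *\<^sub>v (transpose_mat ?U *\<^sub>v x) = transpose_mat (?U * ?A) *\<^sub>v x"
      using x A' U' by (simp add: transpose_mult[OF U' A'] assoc_mult_mat_vec[of _ n m _ m])
    then show ?thesis
      unfolding UA' using x j m
      by (simp add: scalar_prod_def atLeast0LessThan if_distrib[of "\<lambda>x. x * _"] cong: if_cong)
  qed
  have AB: "transpose_mat ?A *\<^sub>v (B *\<^sub>v z) = 0\<^sub>v n" if "z \<in> carrier_vec q" for z
    unfolding U_pad[OF that, symmetric]
    by (rule eq_vecI) (use A m AU[OF pad_carrier] in \<open>auto simp: pad_def\<close>)
  have gen: "\<exists>z \<in> carrier_vec q. v = B *\<^sub>v z" if v: "v \<in> mat_kernel (transpose_mat ?A)" for v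
  proof -
    have v: "v \<in> carrier_vec m" "transpose_mat ?A *\<^sub>v v = 0\<^sub>v n"
      using v A' mat_kernel[of "transpose_mat ?A" n m] by auto
    define x where "x = transpose_mat ?W *\<^sub>v v"
    have x: "x \<in> carrier_vec m" using W' v by (simp add: x_def)
    have Ux: "transpose_mat ?U *\<^sub>v x = v"
      unfolding x_def using v U' W' UW_T
      by (subst assoc_mult_mat_vec[symmetric, of _ m m _ m]) auto
    have "x $ j = 0" if "j < n" for j
      using AU[OF x that] unfolding Ux v(2) using that by simp
    then have "pad (vec q (\<lambda>l. x $ (n + l))) = x"
      by (intro eq_vecI) (use x m in \<open>auto simp: pad_def\<close>)
    then have "v = transpose_mat ?U *\<^sub>v pad (vec q (\<lambda>l. x $ (n + l)))"
      by (simp only: Ux)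
    also have "\<dots> = B *\<^sub>v vec q (\<lambda>l. x $ (n + l))" by (rule U_pad) simp
    finally show ?thesis by (intro bexI) auto
  qed
  have inj: "z = 0\<^sub>v q" if z: "z \<in> carrier_vec q" "B *\<^sub>v z = 0\<^sub>v m" for z
  proof -
    have "pad z = transpose_mat ?W *\<^sub>v (transpose_mat ?U *\<^sub>v pad z)"
      using pad_carrier[of z] U' W' WU_T by (subst assoc_mult_mat_vec[symmetric, of _ m m _ m]) auto
    also have "\<dots> = 0\<^sub>v m" unfolding U_pad[OF z(1)] z(2) using W' by (intro eq_vecI) auto
    finally have "pad z $ (n + l) = 0" if "l < q" for l using that m by simp
    then show ?thesis using z(1) m by (intro eq_vecI) (auto simp: pad_def)
  qed
  have AT: "transpose_mat ?A \<in> carrier_mat n m" using A' by simp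
  show "kernel.basis m (transpose_mat ?A) (set (cols B))" "distinct (cols B)"
    by (rule kernel_basis_of_cols[OF AT B]; (rule AB | rule gen | rule inj); assumption)+
qed

lemma vec_degree_le_iff: "0 < dim_vec v \<Longrightarrow> vec_degree v \<le> k \<longleftrightarrow> (\<forall>i<dim_vec v. degree (v $ i) \<le> k)"
  unfolding vec_degree_def by (subst Max_le_iff) auto

lemma inj_map_vec_to_fract: "inj (map_vec to_fract)"
proof
  fix v w :: "'a vec" assume eq: "map_vec to_fract v = map_vec to_fract w"
  then have "dim_vec v = dim_vec w" by (metis index_map_vec(2))
  moreover have "v $ i = w $ i" if "i < dim_vec w" for i
    using arg_cong[OF eq, of "\<lambda>u. u $ i"] that calculation by simp
  ultimately show "v = w" by (intro eq_vecI) auto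
qed

lemma minimal_indices_zero: "minimal_indices k {0\<^sub>v k} {#}"
proof -
  \<comment> \<open>The zero space is presented as the kernel of an identity matrix, which makes the
    vector space facts of this locale available.\<close>
  interpret kernel k k "1\<^sub>m k :: complex poly fract mat" by unfold_locales auto
  have "mat_kernel (1\<^sub>m k :: complex poly fract mat) = {0\<^sub>v k}"
    by (auto simp: mat_kernel[of _ k k])
  moreover have "basis {}"
  proof -
    have "lin_indpt {}" unfolding Ker.lin_dep_def by auto
    moreover have "span {} = mat_kernel (1\<^sub>m k :: complex poly fract mat)"
      using \<open>mat_kernel (1\<^sub>m k) = {0\<^sub>v k}\<close> Ker.span_empty by simp
    ultimately show ?thesis unfolding Ker.basis_def by simp
  qed
  ultimately have "polynomial_basis k {0\<^sub>v k} {}"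
    unfolding polynomial_basis_def by simp
  then show ?thesis
    unfolding minimal_indices_def minimal_basis_def by (intro exI[of _ "{}"]) simp
qed

section \<open>Degrees of the null family and their minimality\<close>

context good_matpoly
begin

lemma null_vec_degree:
  assumes "null_family N" and l: "l < q"
  shows "vec_degree (vec m (N l)) = \<eta> l"
proof (rule antisym)
  have m: "0 < m" "l < m" using n_less_m l q_add_n by auto
  show "vec_degree (vec m (N l)) \<le> \<eta> l"
    using assms m by (subst vec_degree_le_iff) (auto simp: null_family_def)
  have "coeff (N l l) (\<eta> l) = 1"
    using assms by (auto simp: null_family_def \<eta>_def)
  then have "\<eta> l \<le> degree (N l l)" by (intro le_degree) simp
  also have "\<dots> \<le> vec_degree (vec m (N l))"
    using vec_degree_le_iff[of "vec m (N l)" "vec_degree (vec m (N l))"] m by simp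
  finally show "\<eta> l \<le> vec_degree (vec m (N l))" .
qed

lemma sum_\<eta>: "(\<Sum>l<q. \<eta> l) + s = q * (\<beta> + 1)"
proof -
  have "q = s + (q - s)" using s_le by simp
  then have "(\<Sum>l<q. \<eta> l) = (\<Sum>l<s + (q - s). \<eta> l)" by simp
  also have "\<dots> = s * \<beta> + (q - s) * (\<beta> + 1)"
    unfolding sum_lessThan_add by (simp add: \<eta>_def)
  also have "\<dots> + s = (s + (q - s)) * (\<beta> + 1)" by (simp add: algebra_simps)
  also have "s + (q - s) = q" using s_le by simp
  finally show ?thesis .
qed

lemma image_mset_\<eta>:
  "image_mset \<eta> (mset_set {..<q}) = replicate_mset t (\<beta> + 1) + replicate_mset (q - t) \<beta>"
proof -
  have union: "{..<q} = {..<s} \<union> {s..<q}" using s_le by auto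
  have "mset_set {..<q} = mset_set {..<s} + mset_set {s..<q}"
    unfolding union by (rule mset_set_Union) auto
  moreover have "image_mset \<eta> (mset_set {..<s}) = image_mset (\<lambda>_. \<beta>) (mset_set {..<s})"
    by (intro image_mset_cong) (auto simp: \<eta>_def)
  moreover have "image_mset \<eta> (mset_set {s..<q}) = image_mset (\<lambda>_. \<beta> + 1) (mset_set {s..<q})"
    by (intro image_mset_cong) (auto simp: \<eta>_def)
  ultimately show ?thesis
    using t_less by (simp add: image_mset_const_eq s_def)
qed

lemma left_minimal_indices_Q:
  "left_minimal_indices Q (replicate_mset t (\<beta> + 1) + replicate_mset (q - t) \<beta>)"
proof -
  obtain N where N: "null_family N" using ex_null_family by blast
  obtain L where L: "\<forall>i<n. \<forall>j<n. row_mult m (L i) Q j = (if i = j then 1 else 0)"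
    using ex_left_inverse by blast
  have Q: "Q \<in> carrier_mat m n" using Q_POL by (simp add: POL_def)
  have m: "m = n + q" using q_add_n by simp
  have Nnull: "row_mult m (N l) Q j = 0" if "l < q" "j < n" for l j
    using N that by (auto simp: null_family_def)
  define U where "U = mat m m (\<lambda>(i, r). if i < n then L i r else N (i - n) r)"
  have UA: "U * Q = mat m n (\<lambda>(i, j). if i = j then 1 else 0)"
    and "\<exists>W \<in> carrier_mat m m. W * U = 1\<^sub>m m"
    unfolding U_def using L Nnull null_family_generates[OF N]
    by (intro ex_unimodular_completion[OF Q m]; blast)+
  then obtain W where W: "W \<in> carrier_mat m m" "W * U = 1\<^sub>m m" by blast
  let ?A = "transpose_mat (to_rational_mat Q)"
  have A: "?A \<in> carrier_mat n m" using Q by simp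
  interpret kernel n m ?A using A by unfold_locales
  define B where "B = mat m q (\<lambda>(r, l). to_fract (N l r))"
  have B: "basis (set (cols B))" "distinct (cols B)"
    unfolding B_def using left_kernel_basis[OF Q m U_def UA W] by blast+
  define C where "C = (\<lambda>l. vec m (N l)) ` {..<q}"
  have colB: "col B l = map_vec to_fract (vec m (N l))" if "l < q" for l
    by (rule eq_vecI) (use that in \<open>auto simp: B_def\<close>)
  have cols_B: "set (cols B) = map_vec to_fract ` C"
  proof -
    have "set (cols B) = col B ` {..<q}" by (simp add: cols_def B_def atLeast0LessThan)
    then show ?thesis using colB by (simp add: C_def image_image)
  qed
  have inj: "inj_on (\<lambda>l. vec m (N l)) {..<q}"
  proof (rule inj_onI)
    fix i j assume ij: "i \<in> {..<q}" "j \<in> {..<q}" "vec m (N i) = vec m (N j)"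
    then have "cols B ! i = cols B ! j" using colB by (simp add: B_def)
    moreover have "i < length (cols B)" "j < length (cols B)" using ij by (simp_all add: B_def)
    ultimately show "i = j" using nth_eq_iff_index_eq[OF B(2)] by blast
  qed
  have C: "finite C" "card C = q" using inj by (auto simp: C_def card_image)
  have basis_C: "polynomial_basis m (mat_kernel ?A) C"
    using B(1) unfolding polynomial_basis_def cols_B .
  have sum_C: "(\<Sum>v\<in>C. vec_degree v) = (\<Sum>l<q. \<eta> l)"
    unfolding C_def sum.reindex[OF inj] using null_vec_degree[OF N] by (intro sum.cong) auto
  have "(\<Sum>v\<in>C. vec_degree v) \<le> (\<Sum>v\<in>B'. vec_degree v)" if B': "polynomial_basis m (mat_kernel ?A) B'" for B'
  proof -
    let ?X = "map_vec to_fract ` B'"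
    have X: "basis ?X" using B' unfolding polynomial_basis_def .
    have X': "?X \<subseteq> mat_kernel ?A" "lin_indpt ?X" using X unfolding Ker.basis_def by auto
    \<comment> \<open>Finiteness is not part of being a basis, and a sum over an infinite
      \<open>B'\<close> would be 0 by convention; so it is first derived from finite
      dimension.\<close>
    have fd: "Ker.fin_dim"
      unfolding Ker.fin_dim_def using B(1) unfolding Ker.basis_def by blast
    have finX: "finite ?X" using Ker.li_le_dim(1)[OF fd] X' by simp
    have inj': "inj_on (map_vec to_fract) X" for X :: "complex poly vec set"
      using inj_map_vec_to_fract by (rule inj_on_subset) simp
    have finB': "finite B'" using finX inj' by (rule finite_imageD)
    have "card ?X = card (set (cols B))"
      by (rule trans[OF Ker.dim_basis[OF finX X, symmetric] Ker.dim_basis[OF finite_set B(1)]])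
    then have cardB': "card B' = q"
      unfolding cols_B using C by (simp add: card_image inj')
    define S where "S = map_vec to_fract ` (\<lambda>l. vec m (N l)) ` {..<s}"
    have S_sub: "S \<subseteq> set (cols B)" using s_le unfolding S_def cols_B C_def by auto
    have S_ker: "S \<subseteq> mat_kernel ?A" using S_sub B(1) unfolding Ker.basis_def by auto
    have b_props: "b \<in> carrier_vec m \<and> map_vec to_fract b \<noteq> 0\<^sub>v m \<and> (\<forall>j<n. row_mult m (\<lambda>r. b $ r) Q j = 0)"
      if "b \<in> B'" for b
    proof (intro conjI allI impI)
      have ker: "map_vec to_fract b \<in> mat_kernel ?A" using X'(1) that by auto
      then have b: "map_vec to_fract b \<in> carrier_vec m" "?A *\<^sub>v map_vec to_fract b = 0\<^sub>v n"
        using mat_kernel[OF A] by auto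
      show bm: "b \<in> carrier_vec m" using carrier_vecD[OF b(1)] by (intro carrier_vecI) simp
      have "0\<^sub>v m \<notin> ?X" using Ker.vs_zero_lin_dep[of ?X] X' by simp
      moreover have "map_vec to_fract b \<in> ?X" using that by (rule imageI)
      ultimately show "map_vec to_fract b \<noteq> 0\<^sub>v m" by metis
      fix j assume j: "j < n"
      have "to_fract (row_mult m (\<lambda>r. b $ r) Q j) = (?A *\<^sub>v map_vec to_fract b) $ j"
        using Q bm j by (auto simp: row_mult_def scalar_prod_def to_fract_hom.hom_sum atLeast0LessThan mult.commute intro!: sum.cong)
      also have "\<dots> = 0" using b(2) j by simp
      finally show "row_mult m (\<lambda>r. b $ r) Q j = 0" by simp
    qed
    have coeffs: "\<exists>a. (\<forall>l<q. \<forall>i. vec_degree b < i + \<eta> l \<longrightarrow> coeff (a l) i = 0) \<and> (\<forall>r<m. b $ r = (\<Sum>l<q. a l * N l r))"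
      if "b \<in> B'" for b
    proof (rule null_family_spans[OF N])
      show "degree (b $ r) \<le> vec_degree b" if "r < m" for r
        using vec_degree_le_iff[of b "vec_degree b"] b_props[OF \<open>b \<in> B'\<close>] that by auto
      show "row_mult m (\<lambda>r. b $ r) Q j = 0" if "j < n" for j
        using b_props[OF \<open>b \<in> B'\<close>] that by blast
    qed
    \<comment> \<open>Below degree \<beta> the bound leaves no coefficient in the expansion by N, so
      the vector would be 0.\<close>
    have ge: "\<beta> \<le> vec_degree b" if b: "b \<in> B'" for b
    proof (rule ccontr)
      assume less: "\<not> \<beta> \<le> vec_degree b"
      obtain a where a: "\<forall>l<q. \<forall>i. vec_degree b < i + \<eta> l \<longrightarrow> coeff (a l) i = 0"
        "\<forall>r<m. b $ r = (\<Sum>l<q. a l * N l r)"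
        using coeffs[OF b] by blast
      have "a l = 0" if "l < q" for l
        using a(1) that less by (intro poly_eqI) (auto simp: \<eta>_def)
      then have "b $ r = 0" if "r < m" for r using a(2) that by simp
      then have "map_vec to_fract b = 0\<^sub>v m" using b_props[OF b] by (intro eq_vecI) auto
      then show False using b_props[OF b] by blast
    qed
    define Low where "Low = {b \<in> B'. vec_degree b \<le> \<beta>}"
    \<comment> \<open>Up to degree \<beta> the bound kills the coefficients of the long vectors.
      Hence the independent vectors of \<open>Low\<close> lie in the span of at most s short
      ones.\<close>
    have low_span: "map_vec to_fract ` Low \<subseteq> span S"
    proof
      fix x assume "x \<in> map_vec to_fract ` Low"
      then obtain b where b: "b \<in> B'" "vec_degree b \<le> \<beta>" "x = map_vec to_fract b"
        unfolding Low_def by auto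
      obtain a where a: "\<forall>l<q. \<forall>i. vec_degree b < i + \<eta> l \<longrightarrow> coeff (a l) i = 0"
        "\<forall>r<m. b $ r = (\<Sum>l<q. a l * N l r)"
        using coeffs[OF b(1)] by blast
      have "a l = 0" if "l < q" "s \<le> l" for l
        using a(1) that b(2) by (intro poly_eqI) (auto simp: \<eta>_def)
      then have b_eq: "b $ r = (\<Sum>l<s. a l * N l r)" if "r < m" for r
        using a(2) that s_le by (auto intro!: sum.mono_neutral_right)
      have inj_s: "inj_on (\<lambda>l. map_vec to_fract (vec m (N l))) {..<s}"
      proof (rule inj_onI)
        fix l l' assume l: "l \<in> {..<s}" "l' \<in> {..<s}"
          and "map_vec to_fract (vec m (N l)) = map_vec to_fract (vec m (N l'))"
        then have "vec m (N l) = vec m (N l')" using injD[OF inj_map_vec_to_fract] by blast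
        then show "l = l'" using inj_onD[OF inj, of l l'] l s_le by simp
      qed
      define f where "f x = to_fract (a (the_inv_into {..<s} (\<lambda>l. map_vec to_fract (vec m (N l))) x))" for x
      have f: "f (map_vec to_fract (vec m (N l))) = to_fract (a l)" if "l < s" for l
        using the_inv_into_f_f[OF inj_s, of l] that by (simp add: f_def)
      have S_eq: "S = (\<lambda>l. map_vec to_fract (vec m (N l))) ` {..<s}" by (simp add: S_def image_image)
      have "x = lincomb f S"
      proof (rule eq_vecI)
        have dim: "lincomb f S \<in> carrier_vec m"
          using Ker.lincomb_closed[of S f] S_ker mat_kernel[OF A] by auto
        then show "dim_vec x = dim_vec (lincomb f S)" using b b_props by auto
        fix r assume "r < dim_vec (lincomb f S)"
        then have r: "r < m" using dim by simp
        have "lincomb f S $ r = (\<Sum>v\<in>S. f v * v $ r)" by (rule lincomb_index[OF r S_ker])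
        also have "\<dots> = (\<Sum>l<s. to_fract (a l) * to_fract (N l r))"
          unfolding S_eq sum.reindex[OF inj_s] using f r by (intro sum.cong) auto
        also have "\<dots> = x $ r"
        proof -
          have "x $ r = to_fract (b $ r)" using b(3) b_props[OF b(1)] r by auto
          then show ?thesis using b_eq[OF r] by (simp add: to_fract_hom.hom_sum)
        qed
        finally show "x $ r = lincomb f S $ r" ..
      qed
      then show "x \<in> span S" unfolding Ker.span_def S_eq by auto
    qed
    have "card Low = card (map_vec to_fract ` Low)" by (simp add: card_image inj')
    also have "\<dots> \<le> card S"
    proof (rule card_le_if_in_span)
      show "lin_indpt (map_vec to_fract ` Low)"
        by (rule Ker.subset_li_is_li[OF X'(2)]) (auto simp: Low_def)
    qed (use finB' S_ker low_span in \<open>auto simp: Low_def S_def\<close>)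
    also have "\<dots> \<le> s" unfolding S_def image_image using card_image_le[of "{..<s}"] by (metis card_lessThan finite_lessThan)
    finally have low: "card Low \<le> s" .
    \<comment> \<open>All q vectors have degree at least \<beta> + 1, except for at most s of degree
      \<beta>. This gives the lower bound q (\<beta> + 1) - s, which C attains.\<close>
    have "q * (\<beta> + 1) = (\<Sum>b\<in>B'. \<beta> + 1)" using cardB' by simp
    also have "\<dots> \<le> (\<Sum>b\<in>B'. vec_degree b + (if b \<in> Low then 1 else 0))"
      using ge by (intro sum_mono) (fastforce simp: Low_def)
    also have "\<dots> = (\<Sum>b\<in>B'. vec_degree b) + card Low"
    proof -
      have "(\<Sum>b\<in>B'. if b \<in> Low then 1 else 0 :: nat) = card Low"
        using finB' by (simp add: sum.If_cases Low_def Int_def)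
      then show ?thesis by (simp add: sum.distrib)
    qed
    finally show ?thesis using low sum_\<eta> sum_C by linarith
  qed
  then have "minimal_basis m (mat_kernel ?A) C"
    using basis_C unfolding minimal_basis_def by blast
  moreover have "image_mset vec_degree (mset_set C) = image_mset \<eta> (mset_set {..<q})"
  proof -
    have "image_mset vec_degree (mset_set C) = image_mset (\<lambda>l. vec_degree (vec m (N l))) (mset_set {..<q})"
      unfolding C_def using image_mset_mset_set[OF inj, symmetric] by (simp add: image_mset.compositionality comp_def)
    also have "\<dots> = image_mset \<eta> (mset_set {..<q})"
      using null_vec_degree[OF N] by (intro image_mset_cong) auto
    finally show ?thesis .
  qed
  ultimately show ?thesis
    unfolding left_minimal_indices_def minimal_indices_def using Q image_mset_\<eta> by auto
qed

lemma Klp_eigenstructure_Q: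
  "has_complete_eigenstructure d Q (Klp_eigenstructure m n d)" and normal_rank_Q: "normal_rank Q = n"
proof -
  obtain N where N: "null_family N" using ex_null_family by blast
  have Q: "Q \<in> carrier_mat m n" using Q_POL by (simp add: POL_def)
  have m: "m = n + q" "n \<le> m" using q_add_n by auto
  \<comment> \<open>Stated for a general A because it is applied both to \<open>Q\<close> and to its
    reversal.\<close>
  have inv: "normal_rank A = n \<and> smith_invariants A (replicate n 1) \<and> mat_kernel (to_rational_mat A) = {0\<^sub>v n}"
    if A: "A \<in> carrier_mat m n"
      and L: "\<forall>i<n. \<forall>j<n. row_mult m (L i) A j = (if i = j then 1 else 0)"
      and M: "\<forall>l<q. \<forall>j<n. row_mult m (M l) A j = 0"
      and span: "\<And>y. (\<And>j. j < n \<Longrightarrow> row_mult m y A j = 0) \<Longrightarrow> \<exists>a. \<forall>r<m. y r = (\<Sum>l<q. a l * M l r)"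
    for A L M
  proof -
    let ?U = "mat m m (\<lambda>(i, r). if i < n then L i r else M (i - n) r)"
    have UA: "?U * A = mat m n (\<lambda>(i, j). if i = j then 1 else 0)"
      and "\<exists>W \<in> carrier_mat m m. W * ?U = 1\<^sub>m m"
      using L M span by (intro ex_unimodular_completion[OF A m(1)]; blast)+
    then obtain W where W: "W \<in> carrier_mat m m" "W * ?U = 1\<^sub>m m" by blast
    show ?thesis
      using smith_invariants_left_invertible[OF A _ UA W m(2)] by simp
  qed
  obtain L where L: "\<forall>i<n. \<forall>j<n. row_mult m (L i) Q j = (if i = j then 1 else 0)"
    using ex_left_inverse by blast
  have Nnull: "\<forall>l<q. \<forall>j<n. row_mult m (N l) Q j = 0"
    using N by (auto simp: null_family_def)
  have 1: "normal_rank Q = n \<and> smith_invariants Q (replicate n 1) \<and> mat_kernel (to_rational_mat Q) = {0\<^sub>v n}"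
    by (rule inv[OF Q L Nnull null_family_generates[OF N]])
  then show "normal_rank Q = n" by blast
  obtain L' where L': "\<forall>i<n. \<forall>j<n. row_mult m (L' i) (rev_mat d Q) j = (if i = j then 1 else 0)"
    using ex_rev_left_inverse by blast
  have rev_null: "\<forall>l<q. \<forall>j<n. row_mult m (\<lambda>r. rev_poly (\<eta> l) (N l r)) (rev_mat d Q) j = 0"
    using N row_mult_rev[OF Q_POL] by (auto simp: null_family_def)
  have 2: "smith_invariants (rev_mat d Q) (replicate n 1)"
    using inv[OF rev_mat_carrier[OF Q] L' rev_null rev_null_family_spans[OF N]] by blast
  have "right_minimal_indices Q {#}"
    unfolding right_minimal_indices_def using 1 Q minimal_indices_zero[of n] by simp
  then show "has_complete_eigenstructure d Q (Klp_eigenstructure m n d)"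
    unfolding has_complete_eigenstructure_def Klp_eigenstructure_def Let_def
    using 1 2 left_minimal_indices_Q elementary_divisors_replicate_1[of n]
    by (auto simp: \<beta>_def t_def q_def intro!: exI[of _ "replicate n 1"])
qed

end

section \<open>An explicit good matrix polynomial\<close>

context grade_size
begin

text \<open>The points \<open>brk 0, \<dots>, brk q\<close> cut \<open>[0, n d]\<close> into pieces whose lengths \<open>gap r\<close> are the left
  minimal indices, the multiples of \<open>d\<close> cut it into \<open>n\<close> pieces, one per column of \<open>Klp\<close>.
  Row \<open>r < q\<close> corresponds to the point \<open>brk r\<close>, row \<open>q + i\<close> to the point \<open>(i + 1) d\<close>.\<close>

definition brk :: "nat \<Rightarrow> nat" where "brk r = r * \<beta> + (r - s)"

definition gap :: "nat \<Rightarrow> nat" where "gap r = (if r < s then \<beta> else \<beta> + 1)"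

lemma brk_Suc: "brk (Suc r) = brk r + gap r"
  by (auto simp: brk_def gap_def Suc_diff_le)

lemma brk_mono: "r \<le> r' \<Longrightarrow> brk r \<le> brk r'"
  by (rule lift_Suc_mono_le[of brk]) (simp_all add: brk_Suc)

lemma brk_q: "brk q = n * d"
  by (simp add: brk_def nd_eq t_eq)

lemma brk_less: 
  assumes "r < q" shows "brk r < n * d"
\<comment> \<open>If \<beta> = 0, the first s pieces are empty and strict growth fails there, but
  \<open>brk r\<close> is then 0.\<close>
proof (cases "r < s \<and> \<beta> = 0")
  case True
  then show ?thesis using n_pos d_pos by (simp add: brk_def)
next
  case False
  then have "brk r < brk (Suc r)" by (auto simp: brk_Suc gap_def)
  also have "\<dots> \<le> n * d" using brk_mono[of "Suc r" q] assms brk_q by simp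
  finally show ?thesis .
qed

definition Klp :: "complex poly mat" where
  "Klp = mat m n (\<lambda>(r, j).
     if r < q then (if j = brk r div d then monom 1 (brk r mod d) else 0)
     else if j = r - q then - monom 1 d else if j = Suc (r - q) then 1 else 0)"

lemma Klp_POL: "Klp \<in> POL d m n"
proof -
  have "degree (monom (1 :: complex) (brk r mod d)) \<le> d" for r
    using degree_monom_le[of "1 :: complex" "brk r mod d"] mod_less_divisor[OF d_pos, of "brk r"]
    by linarith
  moreover have "degree (- monom (1 :: complex) d) \<le> d" by (simp add: degree_monom_le)
  ultimately show ?thesis by (simp add: POL_def Klp_def)
qed

lemma matpoly_degree_Klp: "matpoly_degree Klp = d"
proof -
  let ?D = "(\<lambda>ij. degree (Klp $$ ij)) ` ({..<m} \<times> {..<n})"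
  have dims: "dim_row Klp = m" "dim_col Klp = n" by (simp_all add: Klp_def)
  have q: "q < m" using q_add_n n_pos by linarith
  have "degree (Klp $$ (q, 0)) = d" using q n_pos by (simp add: Klp_def degree_monom_eq)
  then have "d \<in> ?D" using q n_pos by (intro image_eqI[of _ _ "(q, 0)"]) auto
  moreover have "x \<le> d" if "x \<in> ?D" for x
    using that Klp_POL by (auto simp: POL_def)
  ultimately show ?thesis
    unfolding matpoly_degree_def dims by (intro Max_eqI) auto
qed

text \<open>The entry of \<open>y\<close> at the row of the point \<open>i d\<close>; the point 0 has no such row.\<close>

definition tail :: "(nat \<Rightarrow> complex poly) \<Rightarrow> nat \<Rightarrow> complex poly" where
  "tail y i = (case i of 0 \<Rightarrow> 0 | Suc i \<Rightarrow> y (q + i))"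

text \<open>Column j meets the last n rows in two places: 1 in the row of the point j d and -
  \<lambda>^d in that of (j + 1) d. For j = 0 the former is absent, which
  \<open>tail y 0 = 0\<close> accounts for.\<close>

lemma row_mult_Klp:
  assumes j: "j < n"
  shows "row_mult m y Klp j =
    (\<Sum>r<q. if j = brk r div d then monom 1 (brk r mod d) * y r else 0) +
    tail y j - monom 1 d * tail y (Suc j)"
proof -
  have entry: "Klp $$ (q + i, j) = (if j = i then - monom 1 d else if j = Suc i then 1 else 0)"
    if "i < n" for i
    using that j q_add_n by (simp add: Klp_def)
  have "row_mult m y Klp j = (\<Sum>r<q + n. y r * Klp $$ (r, j))"
    by (simp add: row_mult_def q_add_n)
  also have "\<dots> = (\<Sum>r<q. if j = brk r div d then monom 1 (brk r mod d) * y r else 0) +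
      (\<Sum>i<n. y (q + i) * Klp $$ (q + i, j))"
    unfolding sum_lessThan_add using j q_add_n
    by (intro arg_cong2[of _ _ _ _ "(+)"] sum.cong) (auto simp: Klp_def)
  also have "(\<Sum>i<n. y (q + i) * Klp $$ (q + i, j)) = tail y j - monom 1 d * tail y (Suc j)"
  proof -
    have "(\<Sum>i<n. y (q + i) * Klp $$ (q + i, j)) =
        (\<Sum>i<n. (if j = i then - (monom 1 d * y (q + i)) else 0) + (if j = Suc i then y (q + i) else 0))"
      using entry by (intro sum.cong) auto
    also have "\<dots> = (\<Sum>i<n. if j = Suc i then y (q + i) else 0) - monom 1 d * y (q + j)"
      using j by (simp add: sum.distrib)
    also have "(\<Sum>i<n. if j = Suc i then y (q + i) else 0) = tail y j"
      using j by (cases j) (auto simp: tail_def)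
    finally show ?thesis by (simp add: tail_def)
  qed
  finally show ?thesis by simp
qed

text \<open>Weighting column \<open>j\<close> by \<open>\<lambda>\<^bsup>jd\<^esup>\<close> makes the last \<open>n\<close> rows telescope, which leaves the row
  with entries \<open>\<lambda>\<^bsup>brk r\<^esup>\<close>, a polynomial of grade \<open>n d\<close>.\<close>

lemma Klp_weighted_sum:
  "(\<Sum>j<n. monom 1 (j * d) * row_mult m y Klp j) =
     (\<Sum>r<q. monom 1 (brk r) * y r) - monom 1 (n * d) * tail y n"
proof -
  have "(\<Sum>j<n. monom 1 (j * d) * row_mult m y Klp j) =
      (\<Sum>j<n. (\<Sum>r<q. if j = brk r div d then monom 1 (brk r) * y r else 0) +
         (monom 1 (j * d) * tail y j - monom 1 (Suc j * d) * tail y (Suc j)))"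
  proof (rule sum.cong)
    fix j assume "j \<in> {..<n}"
    then have "monom 1 (j * d) * row_mult m y Klp j =
      monom 1 (j * d) * (\<Sum>r<q. if j = brk r div d then monom 1 (brk r mod d) * y r else 0) +
      (monom 1 (j * d) * tail y j - monom 1 (Suc j * d) * tail y (Suc j))"
      by (simp add: row_mult_Klp algebra_simps mult_monom flip: mult.assoc)
    also have "monom 1 (j * d) * (\<Sum>r<q. if j = brk r div d then monom 1 (brk r mod d) * y r else 0) =
        (\<Sum>r<q. if j = brk r div d then monom 1 (brk r) * y r else 0)"
      unfolding sum_distrib_left by (intro sum.cong) (auto simp: mult_monom simp flip: mult.assoc)
    finally show "monom 1 (j * d) * row_mult m y Klp j =
      (\<Sum>r<q. if j = brk r div d then monom 1 (brk r) * y r else 0) +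
      (monom 1 (j * d) * tail y j - monom 1 (Suc j * d) * tail y (Suc j))" .
  qed simp
  also have "\<dots> = (\<Sum>j<n. \<Sum>r<q. if j = brk r div d then monom 1 (brk r) * y r else 0) +
      (monom 1 (0 * d) * tail y 0 - monom 1 (n * d) * tail y n)"
    unfolding sum.distrib by (subst sum_lessThan_telescope') simp
  also have "(\<Sum>j<n. \<Sum>r<q. if j = brk r div d then monom 1 (brk r) * y r else 0) =
      (\<Sum>r<q. monom 1 (brk r) * y r)"
  proof (subst sum.swap, rule sum.cong)
    fix r assume "r \<in> {..<q}"
    then have "brk r div d < n" using brk_less[of r] d_pos by (simp add: less_mult_imp_div_less)
    then show "(\<Sum>j<n. if j = brk r div d then monom 1 (brk r) * y r else 0) = monom 1 (brk r) * y r"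
      by simp
  qed simp
  finally show ?thesis by (simp add: tail_def)
qed

text \<open>The weighted sum of the vanishing products equates the sum of the
  \<lambda>^(\<open>brk r\<close>) \<open>y r\<close> with a multiple of \<lambda>^(n d).
  Normalisation and degree bound leave \<open>y r\<close> no coefficient of degree
  \<open>gap r\<close> or more, so the summands occupy disjoint ranges of exponents below n d, and
  each is 0.\<close>

lemma Klp_injective:
  assumes deg: "\<And>r. r < m \<Longrightarrow> degree (y r) \<le> \<beta>"
    and null: "\<And>j. j < n \<Longrightarrow> row_mult m y Klp j = 0"
    and short: "\<And>l. l < s \<Longrightarrow> coeff (y l) \<beta> = 0" and r: "r < m"
  shows "y r = 0"
proof -
  have beyond_gap: "coeff (y r) k = 0" if "r < q" "gap r \<le> k" for r k
  proof (cases "k \<le> \<beta>")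
    case True
    then have "r < s" "k = \<beta>" using that by (auto simp: gap_def split: if_splits)
    then show ?thesis using short by simp
  next
    case False
    then show ?thesis using deg[of r] that q_add_n by (intro coeff_eq_0) linarith
  qed
  have eq: "(\<Sum>r<q. monom 1 (brk r) * y r) = monom 1 (n * d) * tail y n"
    using Klp_weighted_sum[of y] null by simp
  have y_q: "y r = 0" if r: "r < q" for r
  proof (rule poly_eqI)
    fix k
    show "coeff (y r) k = coeff 0 k"
    proof (cases "gap r \<le> k")
      case True
      then show ?thesis using beyond_gap r by simp
    next
      case False
      then have less: "brk r + k < brk (Suc r)" by (simp add: brk_Suc)
      have "coeff (monom 1 (brk r') * y r') (brk r + k) = (if r' = r then coeff (y r) k else 0)"
        if r': "r' < q" for r'
      proof (cases r' r rule: linorder_cases)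
        case less
        then have "brk r' + gap r' \<le> brk r" using brk_mono[of "Suc r'" r] by (simp add: brk_Suc)
        then show ?thesis using less beyond_gap[OF r', of "brk r + k - brk r'"]
          by (simp add: coeff_monom_mult)
      next
        case greater
        then have "brk (Suc r) \<le> brk r'" by (intro brk_mono) simp
        then show ?thesis using less greater by (simp add: coeff_monom_mult)
      qed (simp add: coeff_monom_mult)
      then have "coeff (\<Sum>r<q. monom 1 (brk r) * y r) (brk r + k) = (\<Sum>r'<q. if r' = r then coeff (y r) k else 0)"
        unfolding coeff_sum by (intro sum.cong) auto
      also have "\<dots> = coeff (y r) k" using r by simp
      also have "coeff (\<Sum>r<q. monom 1 (brk r) * y r) (brk r + k) = 0"
      proof -
        have "brk (Suc r) \<le> n * d" using brk_mono[of "Suc r" q] r brk_q by simp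
        then show ?thesis unfolding eq using less by (simp add: coeff_monom_mult)
      qed
      finally show ?thesis by simp
    qed
  qed
  \<comment> \<open>With the first q entries gone, column j links neighbouring values of
    \<open>tail\<close>, and \<open>tail y 0 = 0\<close> propagates upwards.\<close>
  have step: "tail y j = monom 1 d * tail y (Suc j)" if "j < n" for j
  proof -
    have "(\<Sum>r<q. if j = brk r div d then monom 1 (brk r mod d) * y r else 0) = 0"
      using y_q by (intro sum.neutral) auto
    then show ?thesis using row_mult_Klp[OF that, of y] null[OF that] by simp
  qed
  have "tail y j = 0" if "j \<le> n" for j
    using that
  proof (induction j)
    case (Suc j)
    then show ?case using step[of j] by simp
  qed (simp add: tail_def)
  then have "y (q + i) = 0" if "i < n" for i
    using that[unfolded less_eq_Suc_le] by (force simp: tail_def)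
  then show ?thesis
    using y_q r q_add_n by (metis add_less_cancel_left le_add_diff_inverse not_le)
qed

text \<open>The block is minus the identity: as d > 0, the entries 1 do not contribute to the
  coefficient of \<lambda>^d.\<close>

lemma Klp_leading:
  assumes "\<And>j. j < n \<Longrightarrow> (\<Sum>i<n. coeff (Klp $$ (q + i, j)) d * x i) = 0" and j: "j < n"
  shows "x j = 0"
proof -
  have "(\<Sum>i<n. coeff (Klp $$ (q + i, j)) d * x i) = (\<Sum>i<n. if i = j then - x i else 0)"
    using j q_add_n d_pos by (intro sum.cong) (auto simp: Klp_def)
  then show ?thesis using assms(1)[OF j] j by simp
qed

lemma good_Klp: "good Klp"
  by (rule finite_not_good_pencil(2)[OF Klp_POL Klp_POL]; (rule Klp_injective | rule Klp_leading); simp)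

section \<open>Density of the good matrix polynomials\<close>

lemma good_dense:
  assumes P: "P \<in> POL d m n" and "0 < e"
  obtains Q where "Q \<in> POL d m n" "good Q" "pol_dist d m n P Q < e"
proof -
  define c where "c = L2_set (\<lambda>(k, i, j). cmod (coeff (Klp $$ (i, j)) k)) ({..d} \<times> {..<m} \<times> {..<n})"
  have c: "0 \<le> c" by (simp add: c_def)
  have dist: "pol_dist d m n P (P + [:\<epsilon>:] \<cdot>\<^sub>m Klp) = cmod \<epsilon> * c" for \<epsilon>
  proof -
    have "pol_dist d m n P (P + [:\<epsilon>:] \<cdot>\<^sub>m Klp) =
        L2_set (\<lambda>x. cmod \<epsilon> * (case x of (k, i, j) \<Rightarrow> cmod (coeff (Klp $$ (i, j)) k))) ({..d} \<times> {..<m} \<times> {..<n})"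
      unfolding pol_dist_L2_set
      by (rule L2_set_cong) (use P Klp_POL in \<open>auto simp: POL_def norm_mult\<close>)
    also have "\<dots> = cmod \<epsilon> * c"
      unfolding c_def by (rule L2_set_right_distrib[symmetric]) simp
    finally show ?thesis .
  qed
  \<comment> \<open>The interval is infinite, whereas only finitely many \<epsilon> are bad.
    Dividing by c + 1 avoids a separate treatment of c = 0.\<close>
  have "infinite (complex_of_real ` {0<..<e / (c + 1)})"
    using \<open>0 < e\<close> c by (subst finite_image_iff) (auto intro!: inj_onI infinite_Ioo)
  moreover have "finite {\<epsilon>. \<not> good (P + [:\<epsilon>:] \<cdot>\<^sub>m Klp)}"
    by (rule finite_not_good_pencil(1)[OF P Klp_POL]; (rule Klp_injective | rule Klp_leading); simp)
  ultimately obtain \<epsilon> where \<epsilon>: "\<epsilon> \<in> complex_of_real ` {0<..<e / (c + 1)}" "good (P + [:\<epsilon>:] \<cdot>\<^sub>m Klp)"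
    by (metis (no_types, lifting) finite_subset mem_Collect_eq subsetI)
  have "cmod \<epsilon> * c \<le> cmod \<epsilon> * (c + 1)" by (simp add: distrib_left)
  also have "\<dots> < e" using \<epsilon>(1) c by (auto simp: pos_less_divide_eq)
  finally have "pol_dist d m n P (P + [:\<epsilon>:] \<cdot>\<^sub>m Klp) < e" by (simp add: dist)
  moreover have "P + [:\<epsilon>:] \<cdot>\<^sub>m Klp \<in> POL d m n"
    using P Klp_POL by (auto simp: POL_def intro!: degree_add_le order_trans[OF degree_smult_le])
  ultimately show ?thesis using that \<epsilon>(2) by blast
qed

section \<open>From density to the closure of the orbit\<close>

lemma good_has_Klp_eigenstructure:
  assumes "Q \<in> POL d m n" and "good Q"
  shows "has_complete_eigenstructure d Q (Klp_eigenstructure m n d)" and "normal_rank Q = n"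
proof -
  interpret good_matpoly m n d Q using assms by unfold_locales
  show "has_complete_eigenstructure d Q (Klp_eigenstructure m n d)"
    by (rule Klp_eigenstructure_Q)
  show "normal_rank Q = n" by (rule normal_rank_Q)
qed

end

theorem theorem3p4:
  fixes m n d :: nat
  assumes "0 < m" and "0 < n" and "0 < d" and "n < m"
  shows "(\<exists>K \<in> POL d m n. matpoly_degree K = d \<and> normal_rank K = n \<and>
            has_complete_eigenstructure d K (Klp_eigenstructure m n d)) \<and>
         (\<forall>K \<in> POL d m n. has_complete_eigenstructure d K (Klp_eigenstructure m n d) \<longrightarrow>
            orbit_closure d K = POL d m n)"
proof -
  interpret grade_size m n d using assms by unfold_locales
  have "orbit_closure d K = POL d m n"
    if K: "K \<in> POL d m n" "has_complete_eigenstructure d K (Klp_eigenstructure m n d)" for K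
  proof -
    interpret Metric_space "POL d m n" "pol_dist d m n" by (rule Metric_space_POL)
    have dims: "dim_row K = m" "dim_col K = n" using K by (auto simp: POL_def)
    \<comment> \<open>Good matrix polynomials share the eigenstructure of K, so those close to P all
      lie in the orbit of K.\<close>
    have "P \<in> mtopology closure_of orbit d K" if P: "P \<in> POL d m n" for P
      unfolding metric_closure_of
    proof (intro CollectI conjI allI impI P)
      fix e :: real assume "0 < e"
      then obtain Q where Q: "Q \<in> POL d m n" "good Q" "pol_dist d m n P Q < e"
        using good_dense[OF P] by blast
      then have "Q \<in> orbit d K"
        unfolding orbit_def same_complete_eigenstructure_def dims
        using K good_has_Klp_eigenstructure by blast
      then show "\<exists>Q\<in>orbit d K. Q \<in> mball P e" using P Q by auto
    qed
    moreover have "mtopology closure_of orbit d K \<subseteq> POL d m n"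
      using closure_of_subset_topspace[of mtopology "orbit d K"] by simp
    ultimately show ?thesis unfolding orbit_closure_def dims by blast
  qed
  then show ?thesis
    using Klp_POL good_has_Klp_eigenstructure[OF Klp_POL good_Klp] matpoly_degree_Klp by blast
qed

end
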